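(* Let $a=(a_1<a_2<\dots<a_k)$ be integers with $0<a_1$, $a_k<n$, and set $a_0=0$, $a_{k+1}=n$. Let $w\in S_n(a)$ be different from the identity. Choose $p\le k$ maximal such that $w(a_p+1)\ne a_p+1$ (then $w(a_p+1)<a_p+1$), and define $u\in S_n(a)$ by $$u(i)=\begin{cases} w(i)&\text{if } i\le a_p \text{ and } w(i)<w(a_p+1),\\ w(i)-1&\text{if } i\le a_p\text{ and } w(i)>w(a_p+1),\\ w(i+1)-1&\text{if } i>a_p,\end{cases}$$ with the convention $w(n+1)=n+1$. Set $\alpha=s_{w(a_p+1)}\cdots s_{a_p-1}s_{a_p}\in S_n(a)$. Then $$\mathfrak{S}_w=\mathfrak{S}_u\cdot e_{a_p+1-w(a_p+1)}(x_1,\dots,x_{a_p})-\sum_{u\xrightarrow{\alpha}v\ne w}\mathfrak{S}_v ,$$ where the sum is over all $v\neq w$ with $u\xrightarrow{\alpha}v$. Moreover, applying this identity recursively (to $w$, then to the permutations $u$ and $v$ on its right-hand side, and so on, stopping at the identity permutation, for which $\mathfrak{S}_{\mathrm{id}}=1$) terminates after finitely many steps, and the resulting expression writes $\mathfrak{S}_w$ as an integral linear combination of products of the form $$e^{(a)}_{i_{a_1},\dots,i_{n-1}}=\prod_{p=1}^k\ \prod_{r=a_p}^{a_{p+1}-1}e_{i_r}(x_1,\dots,x_{a_p}),$$ for integer sequences $(i_{a_1},\dots,i_{n-1})$ such that $0\le i_r\le a_p$ whenever $a_p\le r<a_{p+1}$.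
   Context: $S_n$ is the symmetric group, $\ell$ is Coxeter length, $s_i=(i,i+1)$, $t_{ij}$ is the transposition of $i$ and $j$, products are compositions of functions. $S_n(a)\subset S_n$ is the set of permutations whose descent positions ($i$ with $w(i)>w(i+1)$) lie in $\{a_1,\dots,a_k\}$. $e_i$ denotes the $i$th elementary symmetric polynomial. Schubert polynomials $\mathfrak{S}_w$, $w\in S_n$: $\mathfrak{S}_{w_0}=x_1^{n-1}x_2^{n-2}\cdots x_{n-1}$ for the longest permutation $w_0$, and if $\ell(ws_i)=\ell(w)+1$ then $\mathfrak{S}_w=\bigl(\mathfrak{S}_{ws_i}-\mathfrak{S}_{ws_i}|_{x_i\leftrightarrow x_{i+1}}\bigr)/(x_i-x_{i+1})$. For $\alpha=s_rs_{r+1}\cdots s_m\in S_n$ ($1\le r\le m\le n-1$), of length $\ell=m-r+1$, and $u,v\in S_n$, $u\xrightarrow{\alpha}v$ means that there are integers $b_1,\dots,b_\ell$, $c_1,\dots,c_\ell$ in $\{1,\dots,n\}$ with (1) $b_i\le m<c_i$ for all $i$; (2) $v=u\,t_{b_1c_1}\cdots t_{b_\ell c_\ell}$; (3) $\ell(u\,t_{b_1c_1}\cdots t_{b_ic_i})=\ell(u)+i$ for $1\le i\le\ell$; (4) $b_1,\dots,b_\ell$ are distinct. *)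

theory Defs
  imports
    "HOL-Library.Poly_Mapping"
    "HOL-Library.Multiset"
    "HOL-Library.FuncSet"
    "HOL-Combinatorics.Permutations"
begin

section \<open>Permutations and Coxeter length\<close>

text \<open>
  The group S_n consists of the functions \<open>w :: nat \<Rightarrow> nat\<close> with \<open>w permutes {1..n}\<close>;
  in particular \<open>w (n + 1) = n + 1\<close>. Products are compositions of functions.
\<close>

definition simple_refl :: "nat \<Rightarrow> nat \<Rightarrow> nat" where
  "simple_refl i = transpose i (i + 1)"

definition word_perm :: "nat list \<Rightarrow> nat \<Rightarrow> nat" where
  "word_perm is = foldr (\<circ>) (map simple_refl is) id"

definition cox_length :: "nat \<Rightarrow> (nat \<Rightarrow> nat) \<Rightarrow> nat" where
  "cox_length n w =
     (LEAST l. \<exists>is. set is \<subseteq> {1..<n} \<and> length is = l \<and> word_perm is = w)"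

definition longest_perm :: "nat \<Rightarrow> (nat \<Rightarrow> nat) \<Rightarrow> bool" where
  "longest_perm n w \<longleftrightarrow>
     w permutes {1..n} \<and> (\<forall>v. v permutes {1..n} \<longrightarrow> cox_length n v \<le> cox_length n w)"

text \<open>The set S_n(a), where \<open>a\<close> stands for the sequence \<open>a 1, \<dots>, a k\<close>.\<close>

definition descent_perms :: "nat \<Rightarrow> nat \<Rightarrow> (nat \<Rightarrow> nat) \<Rightarrow> (nat \<Rightarrow> nat) set" where
  "descent_perms n k a =
     {w. w permutes {1..n} \<and> {i \<in> {1..<n}. w i > w (i + 1)} \<subseteq> a ` {1..k}}"


section \<open>Schubert polynomials\<close>

text \<open>
  Integer polynomials in variables indexed by the natural numbers: a monomial is its
  finitely supported exponent vector, a polynomial its finitely supported coefficient function.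
\<close>

type_synonym int_mpoly = "(nat \<Rightarrow>\<^sub>0 nat) \<Rightarrow>\<^sub>0 int"

definition var :: "nat \<Rightarrow> int_mpoly" where
  "var i = Poly_Mapping.single (Poly_Mapping.single i 1) 1"

definition elem_sym :: "nat \<Rightarrow> nat \<Rightarrow> int_mpoly" where
  "elem_sym i m = (\<Sum>J | J \<subseteq> {1..m} \<and> card J = i. \<Prod>j\<in>J. var j)"

definition swap_vars :: "nat \<Rightarrow> int_mpoly \<Rightarrow> int_mpoly" where
  "swap_vars i P = Poly_Mapping.map_key (Poly_Mapping.map_key (transpose i (i + 1))) P"

text \<open>
  The quotient by \<open>var i - var (i + 1)\<close> exists for every \<open>P\<close>, and it is unique since
  \<open>int_mpoly\<close> is an integral domain.
\<close>

definition divided_diff :: "nat \<Rightarrow> int_mpoly \<Rightarrow> int_mpoly" where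
  "divided_diff i P = (THE Q. (var i - var (i + 1)) * Q = P - swap_vars i P)"

inductive is_schubert :: "nat \<Rightarrow> (nat \<Rightarrow> nat) \<Rightarrow> int_mpoly \<Rightarrow> bool" for n :: nat where
  longest: "longest_perm n w \<Longrightarrow> is_schubert n w (\<Prod>i\<in>{1..<n}. var i ^ (n - i))"
| descend: "w permutes {1..n} \<Longrightarrow> i \<in> {1..<n} \<Longrightarrow>
    cox_length n (w \<circ> simple_refl i) = cox_length n w + 1 \<Longrightarrow>
    is_schubert n (w \<circ> simple_refl i) P \<Longrightarrow>
    is_schubert n w (divided_diff i P)"

definition schubert :: "nat \<Rightarrow> (nat \<Rightarrow> nat) \<Rightarrow> int_mpoly" where
  "schubert n w = (THE P. is_schubert n w P)"


section \<open>The relation between permutations labelled by \<open>\<alpha>\<close>\<close>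

text \<open>\<open>transp_chain u b c i\<close> is the product of \<open>u\<close> and the transpositions of \<open>b j\<close> and
  \<open>c j\<close> for \<open>j = 1, \<dots>, i\<close>, from left to right.\<close>

primrec transp_chain ::
    "(nat \<Rightarrow> nat) \<Rightarrow> (nat \<Rightarrow> nat) \<Rightarrow> (nat \<Rightarrow> nat) \<Rightarrow> nat \<Rightarrow> nat \<Rightarrow> nat" where
  "transp_chain u b c 0 = u"
| "transp_chain u b c (Suc i) = transp_chain u b c i \<circ> transpose (b (Suc i)) (c (Suc i))"

definition label_perm :: "nat \<Rightarrow> nat \<Rightarrow> nat \<Rightarrow> nat" where
  "label_perm r m = word_perm [r..<Suc m]"

definition arrow :: "nat \<Rightarrow> (nat \<Rightarrow> nat) \<Rightarrow> (nat \<Rightarrow> nat) \<Rightarrow> (nat \<Rightarrow> nat) \<Rightarrow> bool" where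
  "arrow n \<alpha> u v \<longleftrightarrow>
     (\<exists>r m l b c. 1 \<le> r \<and> r \<le> m \<and> m < n \<and> \<alpha> = label_perm r m \<and> l = m - r + 1 \<and>
        (\<forall>i\<in>{1..l}. b i \<in> {1..n} \<and> c i \<in> {1..n} \<and> b i \<le> m \<and> m < c i) \<and>
        v = transp_chain u b c l \<and>
        (\<forall>i\<in>{1..l}. cox_length n (transp_chain u b c i) = cox_length n u + i) \<and>
        inj_on b {1..l})"


section \<open>The recursion\<close>

definition max_index :: "nat \<Rightarrow> (nat \<Rightarrow> nat) \<Rightarrow> (nat \<Rightarrow> nat) \<Rightarrow> nat" where
  "max_index k a w = (GREATEST p. p \<le> k \<and> w (a p + 1) \<noteq> a p + 1)"

definition rec_perm :: "nat \<Rightarrow> (nat \<Rightarrow> nat) \<Rightarrow> (nat \<Rightarrow> nat) \<Rightarrow> nat \<Rightarrow> nat" where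
  "rec_perm k a w = (let m = a (max_index k a w) in
     (\<lambda>i. if i \<le> m then (if w i < w (m + 1) then w i else w i - 1) else w (i + 1) - 1))"

definition rec_label :: "nat \<Rightarrow> (nat \<Rightarrow> nat) \<Rightarrow> (nat \<Rightarrow> nat) \<Rightarrow> nat \<Rightarrow> nat" where
  "rec_label k a w = (let m = a (max_index k a w) in label_perm (w (m + 1)) m)"

definition rec_others :: "nat \<Rightarrow> nat \<Rightarrow> (nat \<Rightarrow> nat) \<Rightarrow> (nat \<Rightarrow> nat) \<Rightarrow> (nat \<Rightarrow> nat) set" where
  "rec_others n k a w = {v. arrow n (rec_label k a w) (rec_perm k a w) v \<and> v \<noteq> w}"

text \<open>\<open>rec_call n k a w' w\<close>: the identity for \<open>w\<close> has the Schubert polynomial of \<open>w'\<close> on its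
  right-hand side.\<close>

definition rec_call :: "nat \<Rightarrow> nat \<Rightarrow> (nat \<Rightarrow> nat) \<Rightarrow> (nat \<Rightarrow> nat) \<Rightarrow> (nat \<Rightarrow> nat) \<Rightarrow> bool" where
  "rec_call n k a w' w \<longleftrightarrow>
     w \<in> descent_perms n k a \<and> w \<noteq> id \<and> (w' = rec_perm k a w \<or> w' \<in> rec_others n k a w)"

text \<open>
  Fully expanded expressions. The pair \<open>(i, m)\<close> is a formal symbol for \<open>elem_sym i m\<close>, a multiset
  of such pairs a formal product, and an expression is a multiset of formal products with integer
  coefficients. Terms are not collected, so nothing cancels. \<open>expansion n k a w F\<close> states that the
  recursion from \<open>w\<close> comes to an end with the expression \<open>F\<close>.
\<close>

type_synonym formal_expr = "(int \<times> (nat \<times> nat) multiset) multiset"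

inductive expansion ::
    "nat \<Rightarrow> nat \<Rightarrow> (nat \<Rightarrow> nat) \<Rightarrow> (nat \<Rightarrow> nat) \<Rightarrow> formal_expr \<Rightarrow> bool"
  for n k :: nat and a :: "nat \<Rightarrow> nat" where
  identity: "expansion n k a id {#(1, {#})#}"
| recurse: "w \<in> descent_perms n k a \<Longrightarrow> w \<noteq> id \<Longrightarrow> m = a (max_index k a w) \<Longrightarrow>
    expansion n k a (rec_perm k a w) F \<Longrightarrow>
    (\<And>v. v \<in> rec_others n k a w \<Longrightarrow> expansion n k a v (G v)) \<Longrightarrow>
    expansion n k a w
      (image_mset (\<lambda>(c, M). (c, add_mset (m + 1 - w (m + 1), m) M)) F
       + image_mset (\<lambda>(c, M). (- c, M)) (\<Sum>v\<in>rec_others n k a w. G v))"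


section \<open>The products \<open>e\<^sup>(\<^sup>a\<^sup>)\<close>\<close>

text \<open>Index sequences, with the default value outside the index range \<open>{a 1..<n}\<close>.\<close>

definition index_seqs :: "nat \<Rightarrow> nat \<Rightarrow> (nat \<Rightarrow> nat) \<Rightarrow> (nat \<Rightarrow> nat) set" where
  "index_seqs n k a =
     {I \<in> extensional {a 1..<n}. \<forall>p\<in>{1..k}. \<forall>r\<in>{a p..<a (p + 1)}. I r \<le> a p}"

definition e_prod :: "nat \<Rightarrow> (nat \<Rightarrow> nat) \<Rightarrow> (nat \<Rightarrow> nat) \<Rightarrow> int_mpoly" where
  "e_prod k a I = (\<Prod>p\<in>{1..k}. \<Prod>r\<in>{a p..<a (p + 1)}. elem_sym (I r) (a p))"

text \<open>The formal product underlying \<open>e_prod k a I\<close>; the factors \<open>elem_sym 0 (a p) = 1\<close>, which the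
  recursion does not write down, are left out.\<close>

definition e_formal :: "nat \<Rightarrow> (nat \<Rightarrow> nat) \<Rightarrow> (nat \<Rightarrow> nat) \<Rightarrow> (nat \<times> nat) multiset" where
  "e_formal k a I =
     filter_mset (\<lambda>(i, m). i \<noteq> 0) (\<Sum>p\<in>{1..k}. \<Sum>r\<in>{a p..<a (p + 1)}. {#(I r, a p)#})"

end

theory Submission
  imports Defs
begin

text \<open>
  Let \<open>m = a\<^sub>p\<close> and \<open>r = w(m+1)\<close>. Since \<open>u\<close> increases after position \<open>m\<close> and fixes \<open>n\<close>, the identity is an
  instance of the following Pieri formula: the product of the Schubert polynomial of \<open>u\<close> with
  \<open>e\<^sub>l(x\<^sub>1,\<dots>,x\<^sub>m)\<close> is the sum of the Schubert polynomials of all \<open>v\<close> reached from \<open>u\<close> by \<open>l\<close> covers that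
  move distinct positions \<open>b \<le> m\<close>. Each such cover raises the Lehmer code by one at \<open>b\<close> and changes
  nothing else, so \<open>v\<close> is determined by the set of moved positions. If \<open>u\<close> decreases up to \<open>m\<close>, then
  \<open>u\<close> and all \<open>v\<close> have weakly decreasing codes, their Schubert polynomials are the monomials of the
  codes, and the formula is the definition of \<open>e\<^sub>l\<close>. Every other \<open>u\<close> has an ascent \<open>i < m\<close>, and the
  formula for \<open>u\<close> follows from the one for \<open>u s\<^sub>i\<close> by the \<open>i\<close>th divided difference.

  The permutation \<open>w\<close> is the one whose moved positions are those with \<open>u(b) \<ge> r\<close>; every other \<open>v\<close>
  satisfies \<open>v(m+1) < r\<close>. Hence the pair of the largest position that is not fixed and the value at
  position \<open>m+1\<close> decreases lexicographically along the recursion. The first component also bounds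
  the number of factors \<open>e(x\<^sub>1,\<dots>,x\<^sub>m)\<close>, because each one is split off by a step to \<open>u\<close>, which lowers it.
\<close>

section \<open>Divided differences\<close>

text \<open>\<open>schubert\<close> is a definite description over an inductive relation, so the
  first obstacle is that all ways down from the longest permutation give the same polynomial; this
  rests on the commutation and braid relations of divided differences. The induction for the Pieri
  formula works because, for \<open>i < m\<close>, the factor \<open>e_l(x_1,...,x_m)\<close> is
  symmetric in \<open>x_i\<close> and \<open>x_(i+1)\<close> and passes through the
  \<open>i\<close>th divided difference, which kills exactly those permutations reached from
  \<open>u s_i\<close> that have an ascent at \<open>i\<close>. The condition \<open>u n = n\<close>
  keeps the formula inside \<open>S_n\<close>: the last position supplies a value large enough for
  every cover. For the count of factors, the largest non-fixed position of \<open>w\<close> lies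
  beyond \<open>a_p\<close> and at most at \<open>a_(p+1)\<close>, and each factor split off at that
  level lowers it. So at most \<open>a_(p+1) - a_p\<close> of them occur, which is the number of
  indices that the product reserves for the level.\<close>

lemma poly_add_induct [case_names zero single add]:
  fixes P :: "('a \<Rightarrow>\<^sub>0 'b::comm_monoid_add) \<Rightarrow> bool"
  assumes "P 0" "\<And>k v. P (Poly_Mapping.single k v)" "\<And>p q. P p \<Longrightarrow> P q \<Longrightarrow> P (p + q)"
  shows "P p"
proof (induction p rule: Poly_Mapping.update_induct)
  case const
  then show ?case using assms(1) by simp
next
  case (update f a b)
  have "Poly_Mapping.update a b f = f + Poly_Mapping.single a b"
    using update(1)
    by (intro poly_mapping_eqI) (auto simp: lookup_add lookup_update lookup_single when_def in_keys_iff)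
  then show ?case using update assms by metis
qed

text \<open>Reduces identities between composites of \<open>swap_vars\<close> to the variables; the
  closure under products also carries the Leibniz rule that makes divided differences exist.\<close>

lemma int_mpoly_induct [case_names int var add mult]:
  fixes Q :: "int_mpoly \<Rightarrow> bool"
  assumes int: "\<And>c. Q (of_int c)" and var: "\<And>i. Q (var i)"
    and add: "\<And>p q. Q p \<Longrightarrow> Q q \<Longrightarrow> Q (p + q)" and mult: "\<And>p q. Q p \<Longrightarrow> Q q \<Longrightarrow> Q (p * q)"
  shows "Q p"
proof (induction p rule: poly_add_induct)
  case zero
  then show ?case using int[of 0] by simp
next
  case (single k v)
  have "Q (Poly_Mapping.single k 1)"
  proof (induction k rule: poly_add_induct)
    case zero
    then show ?case using int[of 1] by simp
  next
    case (single i e)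
    show ?case
    proof (induction e)
      case 0
      then show ?case using int[of 1] by simp
    next
      case (Suc e)
      have "Poly_Mapping.single (Poly_Mapping.single i (Suc e)) 1
          = (var i * Poly_Mapping.single (Poly_Mapping.single i e) 1 :: int_mpoly)"
        by (simp add: var_def mult_single flip: single_add)
      then show ?case using mult[OF var[of i] Suc] by metis
    qed
  next
    case (add p q)
    then have "Q (Poly_Mapping.single p 1 * Poly_Mapping.single q 1)" by (rule mult)
    then show ?case by (simp add: mult_single)
  qed
  then have "Q (of_int v * Poly_Mapping.single k 1)" by (intro mult int)
  then show ?case by (simp add: mult_single flip: single_of_int)
next
  case (add p q)
  then show ?case by (rule assms(3))
qed

section \<open>Exchange of two neighbouring variables\<close>

lemma inj_transpose [simp]: "inj (transpose a b)"
  by (simp add: bij_is_inj)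

lemma map_key_transpose_self:
  "Poly_Mapping.map_key (transpose a b) (Poly_Mapping.map_key (transpose a b) x) = x"
  by (simp add: map_key_compose id_def[symmetric] map_key_id[unfolded id_def[symmetric]])

lemma inj_map_key_transpose:
  "inj (Poly_Mapping.map_key (transpose a b) :: ('a \<Rightarrow>\<^sub>0 'b::zero) \<Rightarrow> _)"
  by (metis injI map_key_transpose_self)

lemma swap_vars_single:
  "swap_vars i (Poly_Mapping.single k v)
     = Poly_Mapping.single (Poly_Mapping.map_key (transpose i (i + 1)) k) v"
proof -
  let ?s = "Poly_Mapping.map_key (transpose i (i + 1))"
  \<comment> \<open>\<open>map_key_single\<close> only covers keys of the form \<open>?s k\<close>;
    every key has this form because \<open>?s\<close> is an involution.\<close>
  have "swap_vars i (Poly_Mapping.single (?s (?s k)) v) = Poly_Mapping.single (?s k) v"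
    unfolding swap_vars_def by (rule map_key_single[OF inj_map_key_transpose])
  then show ?thesis by (simp only: map_key_transpose_self)
qed

lemma swap_vars_zero [simp]: "swap_vars i 0 = 0"
  unfolding swap_vars_def by (rule map_key_zero[OF inj_map_key_transpose])

lemma swap_vars_add: "swap_vars i (p + q) = swap_vars i p + swap_vars i q"
  unfolding swap_vars_def by (rule map_key_plus[OF inj_map_key_transpose])

lemma swap_vars_mult: "swap_vars i (p * q) = swap_vars i p * swap_vars i q"
proof (induction p rule: poly_add_induct)
  case zero
  then show ?case by simp
next
  case (single k v)
  show ?case
    by (induction q rule: poly_add_induct)
      (simp_all add: swap_vars_single swap_vars_add mult_single map_key_plus distrib_left)
next
  case (add p q)
  then show ?case by (simp add: distrib_right swap_vars_add)
qed

lemma swap_vars_of_int [simp]: "swap_vars i (of_int c) = of_int c"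
  by (simp add: swap_vars_single flip: single_of_int)

lemma swap_vars_one [simp]: "swap_vars i 1 = 1"
  using swap_vars_of_int[of i 1] by simp

lemma swap_vars_uminus: "swap_vars i (- p) = - swap_vars i p"
  using swap_vars_add[of i p "- p"] by (simp add: eq_neg_iff_add_eq_0 add.commute)

lemma swap_vars_diff: "swap_vars i (p - q) = swap_vars i p - swap_vars i q"
  using swap_vars_add[of i p "- q"] by (simp add: swap_vars_uminus)

lemma swap_vars_var [simp]: "swap_vars i (var j) = var (transpose i (i + 1) j)"
proof -
  have "Poly_Mapping.map_key (transpose i (i + 1)) (Poly_Mapping.single j (1::nat))
      = Poly_Mapping.single (transpose i (i + 1) j) 1"
    by (metis inj_transpose map_key_single transpose_involutory)
  then show ?thesis by (simp add: var_def swap_vars_single)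
qed

lemma swap_vars_prod: "swap_vars i (\<Prod>x\<in>A. f x) = (\<Prod>x\<in>A. swap_vars i (f x))"
  by (induction A rule: infinite_finite_induct) (simp_all add: swap_vars_mult)

lemma swap_vars_sum: "swap_vars i (\<Sum>x\<in>A. f x) = (\<Sum>x\<in>A. swap_vars i (f x))"
  by (induction A rule: infinite_finite_induct) (simp_all add: swap_vars_add)

lemma swap_vars_power: "swap_vars i (p ^ e) = swap_vars i p ^ e"
  by (induction e) (simp_all add: swap_vars_mult)

lemma swap_vars_swap_vars [simp]: "swap_vars i (swap_vars i p) = p"
  by (induction p rule: int_mpoly_induct) (simp_all add: swap_vars_mult swap_vars_add)

lemma swap_vars_commute:
  assumes "i + 1 < j"
  shows "swap_vars i (swap_vars j p) = swap_vars j (swap_vars i p)"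
  by (induction p rule: int_mpoly_induct)
    (use assms in \<open>auto simp: swap_vars_mult swap_vars_add transpose_def\<close>)

lemma swap_vars_braid:
  "swap_vars i (swap_vars (i + 1) (swap_vars i p)) =
   swap_vars (i + 1) (swap_vars i (swap_vars (i + 1) p))"
  by (induction p rule: int_mpoly_induct)
    (auto simp: swap_vars_mult swap_vars_add transpose_def)

lemma var_eq_iff [simp]: "var i = var j \<longleftrightarrow> i = j"
  by (metis inj_def inj_single lookup_single_eq lookup_single_not_eq one_neq_zero var_def)

lemma divided_diff_exists: "\<exists>Q. (var i - var (i + 1)) * Q = p - swap_vars i p"
proof (induction p rule: int_mpoly_induct)
  case (int c)
  then show ?case by (intro exI[of _ 0]) simp
next
  case (var j)
  have "(var i - var (i + 1)) * (if j = i then 1 else if j = i + 1 then - 1 else 0)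
      = var j - swap_vars i (var j)"
    by (auto simp: transpose_def)
  then show ?case by blast
next
  case (add p q)
  then obtain P Q where "(var i - var (i + 1)) * P = p - swap_vars i p"
    "(var i - var (i + 1)) * Q = q - swap_vars i q" by blast
  then have "(var i - var (i + 1)) * (P + Q) = p + q - swap_vars i (p + q)"
    by (simp add: distrib_left swap_vars_add)
  then show ?case by blast
next
  case (mult p q)
  then obtain P Q where "(var i - var (i + 1)) * P = p - swap_vars i p"
    "(var i - var (i + 1)) * Q = q - swap_vars i q" by blast
  \<comment> \<open>The twisted Leibniz rule of divided differences.\<close>
  then have "(var i - var (i + 1)) * (P * q + swap_vars i p * Q) = p * q - swap_vars i (p * q)"
    unfolding swap_vars_mult by algebra
  then show ?case by blast
qed

lemma divided_diff_unique:
  assumes "(var i - var (i + 1)) * Q = p - swap_vars i p"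
  shows "divided_diff i p = Q"
  unfolding divided_diff_def
proof (rule the_equality)
  show "(var i - var (i + 1)) * Q = p - swap_vars i p" by fact
  fix R assume "(var i - var (i + 1)) * R = p - swap_vars i p"
  then have "(var i - var (i + 1)) * R = (var i - var (i + 1)) * Q" using assms by simp
  then show "R = Q" by simp
qed

lemma divided_diff_mult_diff: "(var i - var (i + 1)) * divided_diff i p = p - swap_vars i p"
  using divided_diff_exists[of i p] divided_diff_unique by metis

text \<open>The simplifier rewrites \<open>i + 1\<close> to \<open>Suc i\<close>, so only this form
  matches there.\<close>

lemmas divided_diff_mult_diff_Suc = divided_diff_mult_diff[unfolded Suc_eq_plus1[symmetric]]

lemma divided_diff_zero [simp]: "divided_diff i 0 = 0"
  by (rule divided_diff_unique) simp

lemma divided_diff_add: "divided_diff i (p + q) = divided_diff i p + divided_diff i q"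
  by (rule divided_diff_unique) (simp add: distrib_left divided_diff_mult_diff_Suc swap_vars_add)

lemma divided_diff_sum: "divided_diff i (\<Sum>x\<in>A. f x) = (\<Sum>x\<in>A. divided_diff i (f x))"
  by (induction A rule: infinite_finite_induct) (simp_all add: divided_diff_add)

lemma divided_diff_mult_symmetric:
  assumes "swap_vars i q = q"
  shows "divided_diff i (p * q) = divided_diff i p * q"
  by (rule divided_diff_unique)
    (simp only: swap_vars_mult assms divided_diff_mult_diff mult.assoc[symmetric],
      simp only: left_diff_distrib)

lemma swap_vars_divided_diff [simp]: "swap_vars i (divided_diff i p) = divided_diff i p"
proof -
  have "swap_vars i ((var i - var (i + 1)) * divided_diff i p) = swap_vars i (p - swap_vars i p)"
    by (simp only: divided_diff_mult_diff)
  then have "(var (i + 1) - var i) * swap_vars i (divided_diff i p) = swap_vars i p - p"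
    by (simp add: swap_vars_mult swap_vars_diff)
  then have "(var i - var (i + 1)) * swap_vars i (divided_diff i p) = p - swap_vars i p"
    by algebra
  then show ?thesis by (rule divided_diff_unique[symmetric])
qed

lemma divided_diff_symmetric: "swap_vars i p = p \<Longrightarrow> divided_diff i p = 0"
  by (rule divided_diff_unique) simp

lemma divided_diff_swap_vars_commute:
  assumes "i + 1 < j \<or> j + 1 < i"
  shows "divided_diff i (swap_vars j p) = swap_vars j (divided_diff i p)"
proof (rule divided_diff_unique)
  have v: "swap_vars j (var i - var (i + 1)) = var i - var (i + 1)"
    using assms by (auto simp: swap_vars_diff transpose_def)
  have "(var i - var (i + 1)) * swap_vars j (divided_diff i p)
      = swap_vars j ((var i - var (i + 1)) * divided_diff i p)"
    by (simp only: swap_vars_mult v)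
  also have "\<dots> = swap_vars j p - swap_vars j (swap_vars i p)"
    by (simp only: divided_diff_mult_diff swap_vars_diff)
  also have "swap_vars j (swap_vars i p) = swap_vars i (swap_vars j p)"
    using assms swap_vars_commute by metis
  finally show "(var i - var (i + 1)) * swap_vars j (divided_diff i p)
      = swap_vars j p - swap_vars i (swap_vars j p)" .
qed

lemma divided_diff_commute:
  assumes "i + 1 < j \<or> j + 1 < i"
  shows "divided_diff i (divided_diff j p) = divided_diff j (divided_diff i p)"
proof (rule divided_diff_unique)
  have v: "swap_vars j (var i - var (i + 1)) = var i - var (i + 1)"
    using assms by (auto simp: swap_vars_diff transpose_def)
  \<comment> \<open>The factor is fixed by \<open>swap_vars j\<close>, so it moves inside the outer
    divided difference and cancels the inner denominator.\<close>
  have "(var i - var (i + 1)) * divided_diff j (divided_diff i p)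
      = divided_diff j (divided_diff i p * (var i - var (i + 1)))"
    using divided_diff_mult_symmetric[OF v] by (simp add: mult.commute)
  also have "\<dots> = divided_diff j (p + - swap_vars i p)"
    using divided_diff_mult_diff[of i p] by (simp add: mult.commute)
  also have "\<dots> = divided_diff j p + divided_diff j (- 1 * swap_vars i p)"
    by (simp only: divided_diff_add mult_minus_left mult_1)
  also have "divided_diff j (- 1 * swap_vars i p) = - divided_diff j (swap_vars i p)"
    using divided_diff_mult_symmetric[of j "-1" "swap_vars i p"]
    by (simp add: swap_vars_uminus)
  also have "divided_diff j (swap_vars i p) = swap_vars i (divided_diff j p)"
    using divided_diff_swap_vars_commute assms by blast
  finally show "(var i - var (i + 1)) * divided_diff j (divided_diff i p)
      = divided_diff j p - swap_vars i (divided_diff j p)" by simp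
qed

text \<open>Clearing denominators turns both triple products into the antisymmetrisation over the
  permutations of three consecutive variables.\<close>

lemma divided_diff_triple:
  assumes ij: "j = i + 1 \<and> x = var i \<and> y = var (i + 1) \<and> z = var (i + 2) \<or>
      i = j + 1 \<and> x = var (j + 2) \<and> y = var (j + 1) \<and> z = var j"
  shows "(x - y) * (y - z) * (x - z) * divided_diff i (divided_diff j (divided_diff i p)) =
    (if j = i + 1 then 1 else - 1) *
    (p - swap_vars i p - swap_vars j p + swap_vars j (swap_vars i p)
     + swap_vars i (swap_vars j p) - swap_vars i (swap_vars j (swap_vars i p)))"
proof -
  \<comment> \<open>For \<open>i = j + 1\<close> the variables are named in reverse order, which
    flips the sign of both denominators; \<open>s\<close> records this and lets the two cases share
    one computation.\<close>
  define s :: int_mpoly where "s = (if j = i + 1 then 1 else - 1)"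
  have s: "s = 1 \<or> s = - 1" by (simp add: s_def)
  define Q where "Q = divided_diff i p"
  define R where "R = divided_diff j Q"
  define T where "T = divided_diff i R"
  have vi: "var i - var (i + 1) = s * (x - y)" and vj: "var j - var (j + 1) = s * (y - z)"
    using ij by (auto simp: s_def)
  have Q: "s * (x - y) * Q = p - swap_vars i p"
    and R: "s * (y - z) * R = Q - swap_vars j Q"
    and T: "s * (x - y) * T = R - swap_vars i R"
    unfolding Q_def R_def T_def vi[symmetric] vj[symmetric] by (rule divided_diff_mult_diff)+
  have si: "swap_vars i x = y" "swap_vars i y = x" "swap_vars i z = z" "swap_vars i s = s"
    and sj: "swap_vars j x = x" "swap_vars j y = z" "swap_vars j z = y" "swap_vars j s = s"
    using ij by (auto simp: transpose_def s_def swap_vars_uminus)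
  have iQ: "swap_vars i Q = Q" by (simp add: Q_def)
  have "swap_vars i (s * (y - z) * R) = swap_vars i (Q - swap_vars j Q)" using R by simp
  then have iR: "s * (x - z) * swap_vars i R = Q - swap_vars i (swap_vars j Q)"
    by (simp add: swap_vars_mult swap_vars_diff si iQ)
  have "swap_vars j (s * (x - y) * Q) = swap_vars j (p - swap_vars i p)" using Q by simp
  then have jQ: "s * (x - z) * swap_vars j Q = swap_vars j p - swap_vars j (swap_vars i p)"
    by (simp add: swap_vars_mult swap_vars_diff sj)
  then have "swap_vars i (s * (x - z) * swap_vars j Q)
      = swap_vars i (swap_vars j p - swap_vars j (swap_vars i p))" by simp
  then have ijQ: "s * (y - z) * swap_vars i (swap_vars j Q)
      = swap_vars i (swap_vars j p) - swap_vars i (swap_vars j (swap_vars i p))"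
    by (simp add: swap_vars_mult swap_vars_diff si)
  have "(x - y) * (y - z) * (x - z) * T = s *
    (p - swap_vars i p - swap_vars j p + swap_vars j (swap_vars i p)
     + swap_vars i (swap_vars j p) - swap_vars i (swap_vars j (swap_vars i p)))"
    using s
  proof
    assume "s = 1"
    then show ?thesis using Q R T iR jQ ijQ by algebra
  next
    assume "s = - 1"
    then show ?thesis using Q R T iR jQ ijQ by algebra
  qed
  then show ?thesis unfolding T_def R_def Q_def s_def .
qed

text \<open>The two antisymmetrisations of \<open>divided_diff_triple\<close> agree up to sign by
  \<open>swap_vars_braid\<close>, and the products of differences in front change by the same
  sign.\<close>

lemma divided_diff_braid:
  "divided_diff i (divided_diff (i + 1) (divided_diff i p)) =
   divided_diff (i + 1) (divided_diff i (divided_diff (i + 1) p))"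
proof -
  let ?x = "var i" and ?y = "var (i + 1)" and ?z = "var (i + 2)"
  let ?L = "divided_diff i (divided_diff (i + 1) (divided_diff i p))"
  let ?R = "divided_diff (i + 1) (divided_diff i (divided_diff (i + 1) p))"
  have "(?x - ?y) * (?y - ?z) * (?x - ?z) * ?L = - ((?z - ?y) * (?y - ?x) * (?z - ?x) * ?R)"
    using divided_diff_triple[of "i + 1" i ?x ?y ?z p] divided_diff_triple[of i "i + 1" ?z ?y ?x p]
      swap_vars_braid[of i p]
    by simp
  then have "((?x - ?y) * (?y - ?z) * (?x - ?z)) * ?L = ((?x - ?y) * (?y - ?z) * (?x - ?z)) * ?R"
    by algebra
  moreover have "(?x - ?y) * (?y - ?z) * (?x - ?z) \<noteq> 0" by simp
  ultimately show ?thesis by (metis mult_left_cancel)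
qed

section \<open>Inversions and Coxeter length\<close>

text \<open>The Lehmer code: the inversions of \<open>w\<close> with left position
  \<open>i\<close>.\<close>

definition perm_code :: "nat \<Rightarrow> (nat \<Rightarrow> nat) \<Rightarrow> nat \<Rightarrow> nat" where
  "perm_code n w i = card {j \<in> {i<..n}. w j < w i}"

definition inversions :: "nat \<Rightarrow> (nat \<Rightarrow> nat) \<Rightarrow> nat" where
  "inversions n w = (\<Sum>i\<in>{1..n}. perm_code n w i)"

lemma perm_code_le: "perm_code n w i \<le> n - i"
proof -
  have "perm_code n w i \<le> card {i<..n}"
    unfolding perm_code_def by (rule card_mono) auto
  then show ?thesis by simp
qed

lemma simple_refl_simps [simp]:
  "simple_refl i i = Suc i" "simple_refl i (Suc i) = i"
  "j \<noteq> i \<Longrightarrow> j \<noteq> Suc i \<Longrightarrow> simple_refl i j = j"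
  by (auto simp: simple_refl_def transpose_def)

lemma simple_refl_simple_refl [simp]: "simple_refl i (simple_refl i j) = j"
  by (simp add: simple_refl_def)

lemma comp_simple_refl_twice [simp]: "w \<circ> simple_refl i \<circ> simple_refl i = w"
  by (simp add: fun_eq_iff)

lemma inj_simple_refl [simp]: "inj_on (simple_refl i) A"
  by (metis inj_onI simple_refl_simple_refl)

lemma permutes_simple_refl: "i \<in> {1..<n} \<Longrightarrow> simple_refl i permutes {1..n}"
  unfolding simple_refl_def by (rule permutes_swap_id) auto

lemma permutes_comp_simple_refl:
  "w permutes {1..n} \<Longrightarrow> i \<in> {1..<n} \<Longrightarrow> w \<circ> simple_refl i permutes {1..n}"
  by (intro permutes_compose permutes_simple_refl)

text \<open>The two exchanged values carry their code entries along, and the larger one gains the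
  smaller one as an inversion; no other pair of values changes its order.\<close>

lemma perm_code_comp_simple_refl:
  assumes i: "i \<in> {1..<n}" and asc: "w i < w (Suc i)"
  shows "perm_code n (w \<circ> simple_refl i) j =
    (if j = i then perm_code n w (Suc i) + 1 else if j = Suc i then perm_code n w i
     else perm_code n w j)"
proof -
  consider "j = i" | "j = Suc i" | "j > Suc i" | "j < i" by linarith
  then show ?thesis
  proof cases
    case 1
    have "{j \<in> {i<..n}. (w \<circ> simple_refl i) j < (w \<circ> simple_refl i) i}
        = insert (Suc i) {j \<in> {Suc i<..n}. w j < w (Suc i)}" (is "?A = insert _ ?B")
    proof (rule set_eqI)
      fix k
      show "k \<in> ?A \<longleftrightarrow> k \<in> insert (Suc i) ?B"
        using i asc by (cases "k = i \<or> k = Suc i") auto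
    qed
    then show ?thesis using 1 by (simp add: perm_code_def)
  next
    case 2
    have "{j \<in> {Suc i<..n}. (w \<circ> simple_refl i) j < (w \<circ> simple_refl i) (Suc i)}
        = {j \<in> {i<..n}. w j < w i}" (is "?A = ?B")
    proof (rule set_eqI)
      fix k
      show "k \<in> ?A \<longleftrightarrow> k \<in> ?B"
        using i asc by (cases "k = i \<or> k = Suc i") auto
    qed
    then show ?thesis using 2 by (simp add: perm_code_def)
  next
    case 3
    have "{k \<in> {j<..n}. (w \<circ> simple_refl i) k < (w \<circ> simple_refl i) j}
        = {k \<in> {j<..n}. w k < w j}" using 3 by auto
    then show ?thesis using 3 by (simp add: perm_code_def)
  next
    case 4
    have "{k \<in> {j<..n}. (w \<circ> simple_refl i) k < (w \<circ> simple_refl i) j}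
        = simple_refl i ` {k \<in> {j<..n}. w k < w j}" (is "?A = _ ` ?B")
    proof (intro equalityI subsetI)
      fix k assume k: "k \<in> ?A"
      have "simple_refl i k \<in> ?B" using 4 k i by (cases "k = i \<or> k = Suc i") auto
      then show "k \<in> simple_refl i ` ?B" by (metis imageI simple_refl_simple_refl)
    next
      fix k assume "k \<in> simple_refl i ` ?B"
      then obtain l where "k = simple_refl i l" "l \<in> ?B" by blast
      then show "k \<in> ?A" using 4 i by (cases "l = i \<or> l = Suc i") auto
    qed
    then show ?thesis using 4 by (simp add: perm_code_def card_image)
  qed
qed

lemma inversions_ascent:
  assumes i: "i \<in> {1..<n}" and asc: "w i < w (Suc i)"
  shows "inversions n (w \<circ> simple_refl i) = inversions n w + 1"
proof -
  have split: "{1..n} = insert i (insert (Suc i) ({1..n} - {i, Suc i}))" using i by auto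
  have "(\<Sum>j\<in>{1..n} - {i, Suc i}. perm_code n (w \<circ> simple_refl i) j)
      = (\<Sum>j\<in>{1..n} - {i, Suc i}. perm_code n w j)"
    by (rule sum.cong) (auto simp: perm_code_comp_simple_refl[OF assms])
  moreover have "inversions n v = perm_code n v i + (perm_code n v (Suc i)
      + (\<Sum>j\<in>{1..n} - {i, Suc i}. perm_code n v j))" for v
    unfolding inversions_def by (subst split) simp
  ultimately show ?thesis
    by (simp add: perm_code_comp_simple_refl[OF assms])
qed

lemma inversions_descent:
  assumes i: "i \<in> {1..<n}" and desc: "w (Suc i) < w i"
  shows "inversions n w = inversions n (w \<circ> simple_refl i) + 1"
  using inversions_ascent[of i n "w \<circ> simple_refl i"] assms by simp

lemma permutes_Suc_neq: "w permutes S \<Longrightarrow> w i \<noteq> w (Suc i)"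
  by (metis n_not_Suc_n permutes_inj injD)

lemma permutes_no_descent_id:
  assumes w: "w permutes {1..n}" and asc: "\<And>i. i \<in> {1..<n} \<Longrightarrow> w i < w (Suc i)"
  shows "w = id"
proof -
  have ge: "i \<in> {1..n} \<Longrightarrow> i \<le> w i" for i
  proof (induction i)
    case (Suc i)
    show ?case
    proof (cases "i = 0")
      case True
      then show ?thesis using Suc permutes_in_image[OF w, of 1] by simp
    next
      case False
      then have "i \<le> w i" "w i < w (Suc i)" using Suc asc[of i] by auto
      then show ?thesis by simp
    qed
  qed simp
  have "w i = i" for i
  proof (rule ccontr)
    assume ne: "w i \<noteq> i"
    have i: "i \<in> {1..n}" using ne w permutes_not_in by metis
    \<comment> \<open>A single value above its position would make the sum of all values exceed the
      sum of all positions.\<close>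
    have "(\<Sum>j\<in>{1..n}. j) < (\<Sum>j\<in>{1..n}. w j)"
    proof (rule sum_strict_mono_ex1)
      show "\<exists>j\<in>{1..n}. j < w j" using ge[OF i] i ne by (intro bexI[of _ i]) auto
    qed (use ge in auto)
    also have "(\<Sum>j\<in>{1..n}. w j) = (\<Sum>j\<in>{1..n}. j)"
      using sum.permute[OF w, of "\<lambda>x. x"] by (simp add: o_def)
    finally show False by simp
  qed
  then show ?thesis by auto
qed

section \<open>Words in simple reflections and Coxeter length\<close>

lemma word_perm_snoc: "word_perm (is @ [i]) = word_perm is \<circ> simple_refl i"
  by (induction "is") (simp_all add: word_perm_def fun_eq_iff)

lemma word_perm_Nil [simp]: "word_perm [] = id"
  by (simp add: word_perm_def)

lemma inversions_id [simp]: "inversions n id = 0"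
  by (simp add: inversions_def perm_code_def)

lemma inversions_word_perm:
  "set is \<subseteq> {1..<n} \<Longrightarrow> word_perm is permutes {1..n} \<and> inversions n (word_perm is) \<le> length is"
proof (induction "is" rule: rev_induct)
  case Nil
  show ?case by (simp only: word_perm_Nil permutes_id inversions_id list.size le0 simp_thms)
next
  case (snoc i "is")
  let ?w = "word_perm is"
  have IH: "?w permutes {1..n}" "inversions n ?w \<le> length is" and i: "i \<in> {1..<n}"
    using snoc by auto
  have "inversions n (?w \<circ> simple_refl i) \<le> inversions n ?w + 1"
    using inversions_ascent[OF i, of ?w] inversions_descent[OF i, of ?w]
      permutes_Suc_neq[OF IH(1), of i] by linarith
  moreover have "length (is @ [i]) = length is + 1" by simp
  ultimately show ?case
    using IH(2) permutes_comp_simple_refl[OF IH(1) i] unfolding word_perm_snoc by linarith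
qed

text \<open>Bubble sort: removing a descent costs one letter and one inversion, and only the
  identity has no descent.\<close>

lemma word_of_inversions:
  "w permutes {1..n} \<Longrightarrow> \<exists>is. set is \<subseteq> {1..<n} \<and> length is = inversions n w \<and> word_perm is = w"
proof (induction "inversions n w" arbitrary: w rule: less_induct)
  case less
  show ?case
  proof (cases "w = id")
    case True
    then show ?thesis by (intro exI[of _ "[]"]) simp
  next
    case False
    then obtain i where i: "i \<in> {1..<n}" "\<not> w i < w (Suc i)"
      using permutes_no_descent_id less.prems by blast
    then have d: "w (Suc i) < w i" using permutes_Suc_neq[OF less.prems, of i] by linarith
    let ?v = "w \<circ> simple_refl i"
    have inv: "inversions n w = inversions n ?v + 1" by (rule inversions_descent[OF i(1) d])
    have "?v permutes {1..n}" by (rule permutes_comp_simple_refl[OF less.prems i(1)])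
    then obtain "is" where "set is \<subseteq> {1..<n}" "length is = inversions n ?v" "word_perm is = ?v"
      using less.hyps[of ?v] inv by auto
    then show ?thesis using i inv
      by (intro exI[of _ "is @ [i]"]) (simp add: word_perm_snoc)
  qed
qed

lemma cox_length_eq_inversions:
  assumes "w permutes {1..n}"
  shows "cox_length n w = inversions n w"
  unfolding cox_length_def
proof (rule Least_equality)
  show "\<exists>is. set is \<subseteq> {1..<n} \<and> length is = inversions n w \<and> word_perm is = w"
    by (rule word_of_inversions[OF assms])
next
  fix l assume "\<exists>is. set is \<subseteq> {1..<n} \<and> length is = l \<and> word_perm is = w"
  then show "inversions n w \<le> l" using inversions_word_perm by metis
qed

lemma cox_length_ascent_iff:
  assumes w: "w permutes {1..n}" and i: "i \<in> {1..<n}"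
  shows "cox_length n (w \<circ> simple_refl i) = cox_length n w + 1 \<longleftrightarrow> w i < w (Suc i)"
  using inversions_ascent[OF i, of w] inversions_descent[OF i, of w] permutes_Suc_neq[OF w, of i]
  unfolding cox_length_eq_inversions[OF w]
    cox_length_eq_inversions[OF permutes_comp_simple_refl[OF w i]]
  by linarith

lemma inversions_le: "inversions n w \<le> (\<Sum>i\<in>{1..n}. n - i)"
  unfolding inversions_def by (intro sum_mono perm_code_le)

lemma decreasing_imp_less:
  fixes w :: "nat \<Rightarrow> nat"
  assumes "\<And>i. i \<in> {l..<r} \<Longrightarrow> w (Suc i) < w i" "l \<le> i" "i < j" "j \<le> r"
  shows "w j < w i"
  using assms(3,4)
proof (induction j)
  case (Suc j)
  then have "w (Suc j) < w j" using assms(1)[of j] assms(2) by simp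
  then show ?case using Suc by (cases "i = j") auto
qed simp

lemma increasing_imp_less:
  fixes w :: "nat \<Rightarrow> nat"
  assumes "\<And>i. i \<in> {l..<r} \<Longrightarrow> w i < w (Suc i)" "l \<le> i" "i < j" "j \<le> r"
  shows "w i < w j"
  using assms(3,4)
proof (induction j)
  case (Suc j)
  then have "w j < w (Suc j)" using assms(1)[of j] assms(2) by simp
  then show ?case using Suc by (cases "i = j") auto
qed simp

lemma perm_code_decreasing:
  assumes "\<And>i. i \<in> {1..<n} \<Longrightarrow> w (Suc i) < w i" "i \<in> {1..n}"
  shows "perm_code n w i = n - i"
proof -
  have "{j \<in> {i<..n}. w j < w i} = {i<..n}"
    using decreasing_imp_less[of 1 n w] assms by auto
  then show ?thesis by (simp add: perm_code_def)
qed

text \<open>An ascent could be used to lengthen \<open>w\<close>; without ascents every code entry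
  reaches its upper bound \<open>n - i\<close>.\<close>

lemma longest_perm_iff:
  assumes w: "w permutes {1..n}"
  shows "longest_perm n w \<longleftrightarrow> (\<forall>i\<in>{1..<n}. w (Suc i) < w i)"
proof
  assume l: "longest_perm n w"
  show "\<forall>i\<in>{1..<n}. w (Suc i) < w i"
  proof
    fix i assume i: "i \<in> {1..<n}"
    have "cox_length n (w \<circ> simple_refl i) \<le> cox_length n w"
      using l permutes_comp_simple_refl[OF w i] by (simp add: longest_perm_def)
    then show "w (Suc i) < w i"
      using cox_length_ascent_iff[OF w i] permutes_Suc_neq[OF w, of i] by linarith
  qed
next
  assume d: "\<forall>i\<in>{1..<n}. w (Suc i) < w i"
  then have "inversions n w = (\<Sum>i\<in>{1..n}. n - i)"
    unfolding inversions_def by (intro sum.cong perm_code_decreasing) auto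
  then show "longest_perm n w"
    using w inversions_le by (simp add: longest_perm_def cox_length_eq_inversions)
qed

text \<open>Expresses the code by the values up to position \<open>i\<close> alone, so that a
  permutation can be recovered from its code from left to right.\<close>

lemma perm_code_eq_unused:
  assumes u: "u permutes {1..n}" and i: "i \<in> {1..n}"
  shows "perm_code n u i = card {x \<in> {1..n} - u ` {1..<i}. x < u i}"
proof -
  have "u ` {j \<in> {i<..n}. u j < u i} = {x \<in> {1..n} - u ` {1..<i}. x < u i}" (is "?A = ?B")
  proof (intro equalityI subsetI)
    fix x assume "x \<in> ?A"
    then show "x \<in> ?B"
      using i permutes_in_image[OF u] injD[OF permutes_inj[OF u]] by fastforce
  next
    fix x assume x: "x \<in> ?B"
    then obtain j where j: "j \<in> {1..n}" "x = u j" using permutes_image[OF u] by blast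
    then have "j \<noteq> i" "\<not> j < i" using x by auto
    then show "x \<in> ?A" using x j by auto
  qed
  then have "card ?B = card ?A" by simp
  also have "\<dots> = card {j \<in> {i<..n}. u j < u i}"
    by (intro card_image inj_on_subset[OF permutes_inj[OF u]]) simp
  finally show ?thesis by (simp add: perm_code_def)
qed

lemma perm_code_inject:
  assumes w: "w permutes {1..n}" and v: "v permutes {1..n}"
    and eq: "\<And>i. i \<in> {1..n} \<Longrightarrow> perm_code n w i = perm_code n v i"
  shows "w = v"
proof -
  \<comment> \<open>At the first difference the same values have been taken before. Everything
    counted below the smaller value is counted below the larger one, which also counts the smaller
    value itself.\<close>
  have strict: "perm_code n w i < perm_code n v i"
    if w: "w permutes {1..n}" and v: "v permutes {1..n}" and i: "i \<in> {1..n}"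
      and IH: "\<And>j. j < i \<Longrightarrow> w j = v j" and l: "w i < v i" for w v i
  proof -
    have im: "w ` {1..<i} = v ` {1..<i}" using IH by (intro image_cong) auto
    have "w i \<notin> w ` {1..<i}"
      using injD[OF permutes_inj[OF w]] by fastforce
    moreover have "w i \<in> {1..n}" using permutes_in_image[OF w] i by blast
    ultimately have "{x \<in> {1..n} - w ` {1..<i}. x < w i} \<subset> {x \<in> {1..n} - v ` {1..<i}. x < v i}"
      using im l by auto
    then show ?thesis
      unfolding perm_code_eq_unused[OF w i] perm_code_eq_unused[OF v i]
      by (intro psubset_card_mono) auto
  qed
  have "w i = v i" for i
  proof (induction i rule: less_induct)
    case (less i)
    show ?case
    proof (cases "i \<in> {1..n}")
      case True
      show ?thesis
        using strict[OF w v True less.IH] strict[OF v w True less.IH[symmetric]] eq[OF True]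
        by (metis less_irrefl linorder_neqE_nat)
    next
      case False
      then show ?thesis using w v by (simp add: permutes_not_in)
    qed
  qed
  then show ?thesis by auto
qed

subsection \<open>Transpositions that lengthen a permutation\<close>

lemma comp_transpose_simple_refl:
  "w \<circ> transpose b c \<circ> simple_refl i = w \<circ> simple_refl i \<circ> transpose (simple_refl i b) (simple_refl i c)"
proof -
  have "simple_refl i x = y \<longleftrightarrow> x = simple_refl i y" for x y
    by (metis simple_refl_simple_refl)
  then show ?thesis by (simp add: fun_eq_iff transpose_def)
qed

text \<open>Conjugating the exchange of \<open>b + 1\<close> and \<open>c\<close> by
  \<open>simple_refl b\<close> gives that of \<open>b\<close> and \<open>c\<close>. The inner
  exchange lengthens by induction. If the first reflection lengthens, the last one takes back at
  most one; if it shortens, the last one lengthens again.\<close>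

lemma inversions_transpose_less:
  "1 \<le> b \<Longrightarrow> b < c \<Longrightarrow> c \<le> n \<Longrightarrow> w permutes {1..n} \<Longrightarrow> w b < w c \<Longrightarrow>
   inversions n w < inversions n (w \<circ> transpose b c)"
proof (induction "c - b" arbitrary: b w)
  case 0
  then show ?case by simp
next
  case (Suc d)
  have b: "b \<in> {1..<n}" using Suc.prems by simp
  show ?case
  proof (cases "c = Suc b")
    case True
    then have "transpose b c = simple_refl b" by (simp add: simple_refl_def)
    then show ?thesis using inversions_ascent[of b n w] Suc.prems True by simp
  next
    case False
    let ?s = "simple_refl b"
    let ?x = "w \<circ> ?s" and ?y = "w \<circ> ?s \<circ> transpose (Suc b) c"
    have c: "Suc b < c" using False Suc.prems by simp
    have x: "?x permutes {1..n}" by (rule permutes_comp_simple_refl[OF Suc.prems(4) b])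
    have "d = c - Suc b" using Suc.hyps(2) by simp
    then have xy: "inversions n ?x < inversions n ?y"
      using Suc.hyps(1)[of "Suc b" ?x] Suc.prems c x by simp
    have ys: "?y \<circ> ?s = w \<circ> transpose b c"
      using comp_transpose_simple_refl[of "w \<circ> ?s" "Suc b" c b] c by simp
    have yv: "?y b = w (Suc b)" "?y (Suc b) = w c" using c by (simp_all add: transpose_def)
    show ?thesis
    proof (cases "w b < w (Suc b)")
      case True
      have "inversions n ?x = inversions n w + 1" by (rule inversions_ascent[OF b True])
      moreover have "inversions n ?y \<le> inversions n (?y \<circ> ?s) + 1"
      proof (cases "?y b < ?y (Suc b)")
        case True
        then show ?thesis using inversions_ascent[OF b True] by linarith
      next
        case False
        then have "?y (Suc b) < ?y b"
          using permutes_inj[OF permutes_compose[OF permutes_swap_id x], of "Suc b" c] b c Suc.prems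
          by (metis inj_eq n_not_Suc_n linorder_neqE_nat atLeastAtMost_iff le_Suc_eq le_trans less_imp_le)
        then show ?thesis using inversions_descent[OF b, of ?y] by linarith
      qed
      ultimately show ?thesis using xy unfolding ys by linarith
    next
      case False
      then have d: "w (Suc b) < w b" using permutes_Suc_neq[OF Suc.prems(4), of b] by linarith
      have "inversions n w = inversions n ?x + 1" by (rule inversions_descent[OF b d])
      moreover have "?y b < ?y (Suc b)" unfolding yv using d Suc.prems(5) by linarith
      then have "inversions n (?y \<circ> ?s) = inversions n ?y + 1" by (rule inversions_ascent[OF b])
      ultimately show ?thesis using xy unfolding ys by linarith
    qed
  qed
qed

text \<open>A value in between at position \<open>k\<close> would split the exchange into those of
  \<open>b\<close> and \<open>k\<close>, \<open>b\<close> and \<open>c\<close>, \<open>k\<close> and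
  \<open>c\<close>, each of which lengthens, so the total gain would be at least three.\<close>

lemma inversions_transpose_cover:
  assumes bc: "1 \<le> b" "b < c" "c \<le> n" and w: "w permutes {1..n}"
    and inv: "inversions n (w \<circ> transpose b c) = inversions n w + 1"
  shows "w b < w c" and "b < k \<Longrightarrow> k < c \<Longrightarrow> \<not> (w b < w k \<and> w k < w c)"
proof -
  have t: "v \<circ> transpose i j permutes {1..n}"
    if "1 \<le> i" "i < j" "j \<le> n" "v permutes {1..n}" for v i j
    using that by (intro permutes_compose permutes_swap_id) auto
  show lt: "w b < w c"
  proof (rule ccontr)
    assume "\<not> w b < w c"
    moreover have "w b \<noteq> w c" using injD[OF permutes_inj[OF w], of b c] bc by auto
    ultimately have "w c < w b" by simp
    then have "inversions n (w \<circ> transpose b c) < inversions n (w \<circ> transpose b c \<circ> transpose b c)"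
      using bc t[OF bc w] by (intro inversions_transpose_less) auto
    then show False using inv by (simp add: comp_assoc)
  qed
  show "\<not> (w b < w k \<and> w k < w c)" if k: "b < k" "k < c"
  proof
    assume v: "w b < w k \<and> w k < w c"
    let ?x = "w \<circ> transpose b k"
    let ?y = "?x \<circ> transpose b c"
    let ?z = "?y \<circ> transpose k c"
    have x: "?x permutes {1..n}" using t[of b k] bc k w by simp
    have y: "?y permutes {1..n}" using t[of b c] bc k x by simp
    have "inversions n w < inversions n ?x"
      using bc k v by (intro inversions_transpose_less w) auto
    moreover have "inversions n ?x < inversions n ?y"
      using bc k v by (intro inversions_transpose_less x) auto
    moreover have "inversions n ?y < inversions n ?z"
      using bc k v by (intro inversions_transpose_less y) auto
    moreover have "?z = w \<circ> transpose b c"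
      using bc k by (auto simp: fun_eq_iff transpose_def)
    ultimately show False using inv by simp
  qed
qed

section \<open>Schubert polynomials\<close>

lemma is_schubert_permutes: "is_schubert n w P \<Longrightarrow> w permutes {1..n}"
  by (induction rule: is_schubert.induct) (simp_all add: longest_perm_def)

lemma is_schubert_ascent:
  assumes w: "w permutes {1..n}" and i: "i \<in> {1..<n}" "w i < w (Suc i)"
    and P: "is_schubert n (w \<circ> simple_refl i) P"
  shows "is_schubert n w (divided_diff i P)"
  using is_schubert.descend[OF w i(1) _ P] cox_length_ascent_iff[OF w i(1)] i(2) by blast

text \<open>Downward induction on length, matching the descent of Schubert polynomials from the
  longest permutation; it is well-founded because the number of inversions is bounded.\<close>

lemma permutes_ascent_induct [consumes 1, case_names step]:
  assumes w: "w permutes {1..n}"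
    and step: "\<And>w. w permutes {1..n} \<Longrightarrow>
      (\<And>v. v permutes {1..n} \<Longrightarrow> inversions n w < inversions n v \<Longrightarrow> Q v) \<Longrightarrow> Q w"
  shows "Q w"
  using w
proof (induction "(\<Sum>i\<in>{1..n}. n - i) - inversions n w" arbitrary: w rule: less_induct)
  case less
  show ?case
  proof (rule step[OF less.prems])
    fix v assume "v permutes {1..n}" "inversions n w < inversions n v"
    then show "Q v" using less.hyps[of v] inversions_le[of n v] by (simp add: diff_less_mono2)
  qed
qed

lemma is_schubert_exists: "w permutes {1..n} \<Longrightarrow> \<exists>P. is_schubert n w P"
proof (induction w rule: permutes_ascent_induct)
  case (step w)
  show ?case
  proof (cases "longest_perm n w")
    case True
    then show ?thesis using is_schubert.longest by blast
  next
    case False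
    then obtain i where i: "i \<in> {1..<n}" "\<not> w (Suc i) < w i"
      using longest_perm_iff[OF step(1)] by blast
    then have a: "w i < w (Suc i)" using permutes_Suc_neq[OF step(1), of i] by linarith
    then have "inversions n w < inversions n (w \<circ> simple_refl i)"
      using inversions_ascent[OF i(1), of w] by simp
    then obtain P where "is_schubert n (w \<circ> simple_refl i) P"
      using step(2) permutes_comp_simple_refl[OF step(1) i(1)] by blast
    then show ?thesis using is_schubert_ascent[OF step(1) i(1) a] by blast
  qed
qed

lemma simple_refl_comm:
  assumes "i + 1 < j"
  shows "w \<circ> simple_refl i \<circ> simple_refl j = w \<circ> simple_refl j \<circ> simple_refl i"
  using assms by (auto simp: fun_eq_iff simple_refl_def transpose_def)

lemma simple_refl_braid:
  "w \<circ> simple_refl i \<circ> simple_refl (Suc i) \<circ> simple_refl i =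
   w \<circ> simple_refl (Suc i) \<circ> simple_refl i \<circ> simple_refl (Suc i)"
  by (auto simp: fun_eq_iff simple_refl_def transpose_def)

text \<open>Two ascents span a commutation square or a braid hexagon above \<open>w\<close>; the induction
  hypothesis applies to its lower sides.\<close>

lemma is_schubert_unique:
  assumes "w permutes {1..n}" "is_schubert n w P" "is_schubert n w Q"
  shows "P = Q"
  using assms
proof (induction w arbitrary: P Q rule: permutes_ascent_induct)
  case (step w)
  note w = step(1)
  have IH: "P = Q" if "i \<in> {1..<n}" "w i < w (Suc i)"
    "is_schubert n (w \<circ> simple_refl i) P" "is_schubert n (w \<circ> simple_refl i) Q" for i P Q
    using step(2)[of "w \<circ> simple_refl i", OF permutes_comp_simple_refl[OF w that(1)] _ that(3,4)]
      inversions_ascent[OF that(1,2)] by simp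
  \<comment> \<open>The equation for \<open>x\<close> is a separate premise so that one upper
    permutation can be reached through two different words.\<close>
  have up: "is_schubert n v (divided_diff i R)"
    if "v permutes {1..n}" "i \<in> {1..<n}" "v i < v (Suc i)" "x = v \<circ> simple_refl i" "is_schubert n x R"
    for v i x R
    using is_schubert_ascent that by blast
  have far: "divided_diff i P = divided_diff j Q"
    if ij: "i + 1 < j" "i \<in> {1..<n}" "w i < w (Suc i)" "is_schubert n (w \<circ> simple_refl i) P"
      "j \<in> {1..<n}" "w j < w (Suc j)" "is_schubert n (w \<circ> simple_refl j) Q" for i j P Q
  proof -
    let ?x = "w \<circ> simple_refl i \<circ> simple_refl j"
    have wi: "w \<circ> simple_refl i permutes {1..n}" and wj: "w \<circ> simple_refl j permutes {1..n}"
      using permutes_comp_simple_refl[OF w] ij by auto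
    obtain R where R: "is_schubert n ?x R"
      using is_schubert_exists[OF permutes_comp_simple_refl[OF wi \<open>j \<in> {1..<n}\<close>]] by blast
    have "is_schubert n (w \<circ> simple_refl i) (divided_diff j R)"
      using ij by (intro up[OF wi _ _ _ R]) auto
    then have "P = divided_diff j R" using IH ij by blast
    moreover have "is_schubert n (w \<circ> simple_refl j) (divided_diff i R)"
      using ij by (intro up[OF wj _ _ _ R]) (auto intro: simple_refl_comm)
    then have "Q = divided_diff i R" using IH ij by blast
    ultimately show ?thesis using divided_diff_commute ij by blast
  qed
  have near: "divided_diff i P = divided_diff (Suc i) Q"
    if i: "i \<in> {1..<n}" "w i < w (Suc i)" "is_schubert n (w \<circ> simple_refl i) P"
      "Suc i \<in> {1..<n}" "w (Suc i) < w (Suc (Suc i))"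
      "is_schubert n (w \<circ> simple_refl (Suc i)) Q" for i P Q
  proof -
    let ?a = "simple_refl i" and ?b = "simple_refl (Suc i)"
    have p: "w \<circ> ?a permutes {1..n}" "w \<circ> ?b permutes {1..n}"
      "w \<circ> ?a \<circ> ?b permutes {1..n}" "w \<circ> ?b \<circ> ?a permutes {1..n}"
      "w \<circ> ?a \<circ> ?b \<circ> ?a permutes {1..n}"
      using permutes_comp_simple_refl w i(1,4) by blast+
    obtain R where R: "is_schubert n (w \<circ> ?a \<circ> ?b \<circ> ?a) R"
      using is_schubert_exists[OF p(5)] by blast
    have "is_schubert n (w \<circ> ?a \<circ> ?b) (divided_diff i R)"
      using i by (intro up[OF p(3) _ _ _ R]) auto
    then have "is_schubert n (w \<circ> ?a) (divided_diff (Suc i) (divided_diff i R))"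
      using i by (intro up[OF p(1)]) auto
    then have P: "P = divided_diff (Suc i) (divided_diff i R)" using IH i by blast
    have "is_schubert n (w \<circ> ?b \<circ> ?a) (divided_diff (Suc i) R)"
      using i by (intro up[OF p(4) _ _ _ R] simple_refl_braid) auto
    then have "is_schubert n (w \<circ> ?b) (divided_diff i (divided_diff (Suc i) R))"
      using i by (intro up[OF p(2)]) auto
    then have Q: "Q = divided_diff i (divided_diff (Suc i) R)" using IH i by blast
    show ?thesis using divided_diff_braid[of i R] by (simp add: P Q)
  qed
  \<comment> \<open>Keeps the two introduction rules of \<open>is_schubert\<close> from applying to
    the same permutation.\<close>
  have no_asc: "\<not> (i \<in> {1..<n} \<and> cox_length n (w \<circ> simple_refl i) = cox_length n w + 1)"
    if "longest_perm n w" for i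
    using that longest_perm_iff[OF w] cox_length_ascent_iff[OF w, of i] by (meson less_asym)
  from step.prems(1) show ?case
  proof cases
    case P: longest
    from step.prems(2) show ?thesis
      by cases (use P no_asc in auto)
  next
    case P: (descend i P')
    have i: "w i < w (Suc i)" using P cox_length_ascent_iff[OF w] by blast
    from step.prems(2) show ?thesis
    proof cases
      case longest
      then show ?thesis using P no_asc by blast
    next
      case Q: (descend j Q')
      have j: "w j < w (Suc j)" using Q cox_length_ascent_iff[OF w] by blast
      consider "i = j" | "i + 1 < j" | "j + 1 < i" | "j = Suc i" | "i = Suc j" by linarith
      then show ?thesis
      proof cases
        case 1
        then show ?thesis using IH P Q i by blast
      next
        case 2
        then show ?thesis using far P Q i j by blast
      next
        case 3
        then show ?thesis using far P Q i j by metis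
      next
        case 4
        then show ?thesis using near P Q i j by blast
      next
        case 5
        then show ?thesis using near P Q i j by metis
      qed
    qed
  qed
qed

lemma schubert_eqI: "is_schubert n w P \<Longrightarrow> schubert n w = P"
  unfolding schubert_def using is_schubert_unique is_schubert_permutes
  by (intro the_equality) blast+

lemma is_schubert_schubert: "w permutes {1..n} \<Longrightarrow> is_schubert n w (schubert n w)"
  using is_schubert_exists schubert_eqI by metis

lemma divided_diff_schubert_descent:
  assumes w: "w permutes {1..n}" and i: "i \<in> {1..<n}" "w (Suc i) < w i"
  shows "divided_diff i (schubert n w) = schubert n (w \<circ> simple_refl i)"
proof -
  have "is_schubert n (w \<circ> simple_refl i \<circ> simple_refl i) (schubert n w)"
    unfolding comp_simple_refl_twice by (rule is_schubert_schubert[OF w])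
  then have "is_schubert n (w \<circ> simple_refl i) (divided_diff i (schubert n w))"
    using is_schubert_ascent[OF permutes_comp_simple_refl[OF w i(1)] i(1)] i(2) by simp
  then show ?thesis using schubert_eqI by metis
qed

text \<open>Such a polynomial is itself an \<open>i\<close>th divided difference, hence symmetric in
  the two variables.\<close>

lemma divided_diff_schubert_ascent:
  assumes w: "w permutes {1..n}" and i: "i \<in> {1..<n}" "w i < w (Suc i)"
  shows "divided_diff i (schubert n w) = 0"
proof -
  let ?v = "w \<circ> simple_refl i"
  have "schubert n w = divided_diff i (schubert n ?v)"
    using divided_diff_schubert_descent[of ?v n i] permutes_comp_simple_refl[OF w i(1)] i
    by simp
  then show ?thesis by (simp add: divided_diff_symmetric)
qed

section \<open>Dominant permutations and their monomials\<close>

lemma perm_code_mono_ascent: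
  assumes "w i < w (Suc i)"
  shows "perm_code n w i \<le> perm_code n w (Suc i)"
  unfolding perm_code_def
proof (rule card_mono)
  show "{j \<in> {i<..n}. w j < w i} \<subseteq> {j \<in> {Suc i<..n}. w j < w (Suc i)}"
  proof
    fix j assume j: "j \<in> {j \<in> {i<..n}. w j < w i}"
    then have "j \<noteq> Suc i" using assms by auto
    then show "j \<in> {j \<in> {Suc i<..n}. w j < w (Suc i)}" using j assms by auto
  qed
qed simp

lemma perm_code_descent:
  assumes "i \<in> {1..<n}" "w (Suc i) < w i"
  shows "perm_code n w (Suc i) < perm_code n w i"
  unfolding perm_code_def
proof (rule psubset_card_mono)
  show "{j \<in> {Suc i<..n}. w j < w (Suc i)} \<subset> {j \<in> {i<..n}. w j < w i}"
  proof (rule psubsetI)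
    show "{j \<in> {Suc i<..n}. w j < w (Suc i)} \<subseteq> {j \<in> {i<..n}. w j < w i}"
      using assms by auto
    have "Suc i \<in> {j \<in> {i<..n}. w j < w i}" using assms by auto
    then show "{j \<in> {Suc i<..n}. w j < w (Suc i)} \<noteq> {j \<in> {i<..n}. w j < w i}" by blast
  qed
qed simp

lemma divided_diff_var_mult:
  assumes "swap_vars i S = S"
  shows "divided_diff i (var i * S) = S"
  by (rule divided_diff_unique) (simp add: swap_vars_mult assms left_diff_distrib)

lemma swap_vars_monomial:
  assumes i: "i \<in> {1..<n}" and f: "f i = f (Suc i)"
  shows "swap_vars i (\<Prod>j\<in>{1..n}. var j ^ f j) = (\<Prod>j\<in>{1..n}. var j ^ f j)"
proof -
  let ?t = "transpose i (i + 1)"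
  have t: "?t permutes {1..n}" using i by (intro permutes_swap_id) auto
  have "f (?t j) = f j" for j using f by (simp add: transpose_def)
  then have "swap_vars i (\<Prod>j\<in>{1..n}. var j ^ f j) = (\<Prod>j\<in>{1..n}. var (?t j) ^ f (?t j))"
    by (simp add: swap_vars_prod swap_vars_power)
  also have "\<dots> = (\<Prod>j\<in>{1..n}. var j ^ f j)"
    using prod.permute[OF t, of "\<lambda>j. var j ^ f j"] by (simp add: o_def)
  finally show ?thesis .
qed

text \<open>At an ascent \<open>i\<close> the two neighbouring code entries are equal, so going up
  adds one to the entry at \<open>i\<close> and multiplies the monomial by \<open>x_i\<close>; the
  divided difference removes that factor. Taking the least ascent keeps the larger code weakly
  decreasing, because the entries strictly decrease to its left.\<close>

lemma is_schubert_dominant: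
  assumes "w permutes {1..n}" "\<And>i. i \<in> {1..<n} \<Longrightarrow> perm_code n w (Suc i) \<le> perm_code n w i"
  shows "is_schubert n w (\<Prod>i\<in>{1..n}. var i ^ perm_code n w i)"
  using assms
proof (induction w rule: permutes_ascent_induct)
  case (step w)
  note w = step(1) and dom = step.prems
  show ?case
  proof (cases "longest_perm n w")
    case True
    then have "(\<Prod>i\<in>{1..n}. var i ^ perm_code n w i) = (\<Prod>i\<in>{1..n}. var i ^ (n - i))"
      using longest_perm_iff[OF w] perm_code_decreasing[of n w] by (intro prod.cong) auto
    also have "\<dots> = (\<Prod>i\<in>{1..<n}. var i ^ (n - i))"
      by (rule prod.mono_neutral_right) auto
    finally show ?thesis using is_schubert.longest[OF True] by simp
  next
    case False
    define Asc where "Asc = (\<lambda>i. i \<in> {1..<n} \<and> w i < w (Suc i))"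
    define i where "i = (LEAST i. Asc i)"
    obtain i' where "i' \<in> {1..<n}" "\<not> w (Suc i') < w i'"
      using False longest_perm_iff[OF w] by blast
    then have "Asc i'" using permutes_Suc_neq[OF w, of i'] by (auto simp: Asc_def)
    then have "Asc i" unfolding i_def by (rule LeastI)
    then have i: "i \<in> {1..<n}" "w i < w (Suc i)" by (auto simp: Asc_def)
    have below: "w (Suc j) < w j" if "j \<in> {1..<i}" for j
    proof -
      have "\<not> Asc j" using that not_less_Least[of j Asc] by (simp add: i_def)
      then show ?thesis using that i permutes_Suc_neq[OF w, of j] by (auto simp: Asc_def)
    qed
    have eq: "perm_code n w (Suc i) = perm_code n w i"
      using dom[OF i(1)] perm_code_mono_ascent[of w i n] i(2) by simp
    let ?v = "w \<circ> simple_refl i" and ?c = "perm_code n w"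
    have code: "perm_code n ?v j = ?c j + (if j = i then 1 else 0)" for j
      using perm_code_comp_simple_refl[of i n w j] i eq by auto
    have "perm_code n ?v (Suc j) \<le> perm_code n ?v j" if j: "j \<in> {1..<n}" for j
    proof (cases "Suc j = i")
      case True
      then have "?c i < ?c j" using perm_code_descent[OF j] below[of j] j by simp
      then show ?thesis using True by (simp add: code)
    next
      case False
      then show ?thesis using dom[OF j] by (simp add: code)
    qed
    moreover have "inversions n w < inversions n ?v"
      using inversions_ascent[of i n w] i by simp
    ultimately have v: "is_schubert n ?v (\<Prod>j\<in>{1..n}. var j ^ perm_code n ?v j)"
      using step(2) permutes_comp_simple_refl[OF w i(1)] by blast
    have "(\<Prod>j\<in>{1..n}. var j ^ perm_code n ?v j)
        = (\<Prod>j\<in>{1..n}. var j ^ (if j = i then 1 else 0)) * (\<Prod>j\<in>{1..n}. var j ^ ?c j)"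
      by (simp add: code power_add prod.distrib mult.commute)
    also have "(\<Prod>j\<in>{1..n}. var j ^ (if j = i then 1 else 0)) = (\<Prod>j\<in>{1..n}. if j = i then var j else 1)"
      by (rule prod.cong) auto
    also have "\<dots> = var i" using i by simp
    finally have prod: "(\<Prod>j\<in>{1..n}. var j ^ perm_code n ?v j) = var i * (\<Prod>j\<in>{1..n}. var j ^ ?c j)" .
    show ?thesis
      using is_schubert_ascent[OF w i v]
      unfolding prod divided_diff_var_mult[OF swap_vars_monomial[OF i(1) eq[symmetric]]] .
  qed
qed

lemma schubert_dominant:
  assumes "w permutes {1..n}" "\<And>i. i \<in> {1..<n} \<Longrightarrow> perm_code n w (Suc i) \<le> perm_code n w i"
  shows "schubert n w = (\<Prod>i\<in>{1..n}. var i ^ perm_code n w i)"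
  by (rule schubert_eqI[OF is_schubert_dominant[OF assms]])

lemma schubert_id: "schubert n id = 1"
proof -
  have "perm_code n id i = 0" for i by (auto simp: perm_code_def)
  then show ?thesis using schubert_dominant[OF permutes_id, of n] by simp
qed

section \<open>A Pieri formula\<close>

text \<open>\<open>B\<close> is the set of the positions \<open>b\<close> used so far, so that \<open>b \<notin> B\<close> makes them distinct.\<close>

inductive pieri_chain ::
    "nat \<Rightarrow> nat \<Rightarrow> (nat \<Rightarrow> nat) \<Rightarrow> nat set \<Rightarrow> (nat \<Rightarrow> nat) \<Rightarrow> bool"
  for n m :: nat and u :: "nat \<Rightarrow> nat" where
  init: "pieri_chain n m u {} u"
| step: "pieri_chain n m u B x \<Longrightarrow> b \<in> {1..m} \<Longrightarrow> b \<notin> B \<Longrightarrow> c \<in> {m<..n} \<Longrightarrow>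
    inversions n (x \<circ> transpose b c) = inversions n x + 1 \<Longrightarrow>
    pieri_chain n m u (insert b B) (x \<circ> transpose b c)"

lemma pieri_chain_subset: "pieri_chain n m u B x \<Longrightarrow> B \<subseteq> {1..m}"
  by (induction rule: pieri_chain.induct) auto

lemma pieri_chain_finite: "pieri_chain n m u B x \<Longrightarrow> finite B"
  by (rule finite_subset[OF pieri_chain_subset]) auto

lemma permutes_comp_transpose:
  "x permutes {1..n} \<Longrightarrow> b \<in> {1..n} \<Longrightarrow> c \<in> {1..n} \<Longrightarrow> x \<circ> transpose b c permutes {1..n}"
  by (intro permutes_compose permutes_swap_id)

lemma pieri_chain_permutes:
  "pieri_chain n m u B x \<Longrightarrow> u permutes {1..n} \<Longrightarrow> x permutes {1..n}"
proof (induction rule: pieri_chain.induct)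
  case (step B x b c)
  then have "b \<in> {1..n}" "c \<in> {1..n}" by auto
  then show ?case using step permutes_comp_transpose by blast
qed

lemma pieri_chain_inversions:
  "pieri_chain n m u B x \<Longrightarrow> inversions n x = inversions n u + card B"
proof (induction rule: pieri_chain.induct)
  case (step B x b c)
  have "card (insert b B) = card B + 1" using step(3) pieri_chain_finite[OF step(1)] by simp
  then show ?case using step by linarith
qed simp

lemma permutes_neq: "w permutes S \<Longrightarrow> i \<noteq> j \<Longrightarrow> w i \<noteq> w j"
  by (metis permutes_inj injD)

lemma pieri_step_cover:
  assumes "x permutes {1..n}" "b \<in> {1..m}" "c \<in> {m<..n}"
    and "inversions n (x \<circ> transpose b c) = inversions n x + 1"
  shows "x b < x c" and "b < k \<Longrightarrow> k < c \<Longrightarrow> x k < x b \<or> x c < x k"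
proof -
  show "x b < x c" using inversions_transpose_cover(1)[of b c n x] assms by auto
  show "x k < x b \<or> x c < x k" if "b < k" "k < c"
    using inversions_transpose_cover(2)[of b c n x k] assms that
      permutes_neq[OF assms(1), of k b] permutes_neq[OF assms(1), of k c]
    by auto
qed

subsection \<open>Chains and simple reflections\<close>

text \<open>For \<open>i < m\<close> conjugation permutes the positions up to \<open>m\<close> and
  fixes \<open>c\<close>. Only the length condition is not automatic, and it is left as a
  premise.\<close>

lemma pieri_chain_conj_step:
  assumes "pieri_chain n m (u \<circ> simple_refl i) (simple_refl i ` B) (x \<circ> simple_refl i)"
    and i: "i \<in> {1..<m}" and b: "b \<in> {1..m}" "b \<notin> B" and c: "c \<in> {m<..n}"
    and inv: "inversions n (x \<circ> transpose b c \<circ> simple_refl i)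
      = inversions n (x \<circ> simple_refl i) + 1"
  shows "pieri_chain n m (u \<circ> simple_refl i) (simple_refl i ` insert b B)
    (x \<circ> transpose b c \<circ> simple_refl i)"
proof -
  have sc: "simple_refl i c = c" using i c by simp
  have sb: "simple_refl i b \<in> {1..m}" using i b by (cases "b = i \<or> b = Suc i") auto
  have nb: "simple_refl i b \<notin> simple_refl i ` B" using b(2) by (metis image_iff simple_refl_simple_refl)
  have eq: "x \<circ> transpose b c \<circ> simple_refl i = x \<circ> simple_refl i \<circ> transpose (simple_refl i b) c"
    using comp_transpose_simple_refl[of x b c i] sc by simp
  show ?thesis
    using pieri_chain.step[OF assms(1) sb nb c] inv unfolding eq image_insert by blast
qed

text \<open>If \<open>b = i\<close> is raised to the value \<open>x c\<close>, the value at
  \<open>i + 1\<close> lies between the two positions and, by the cover condition, must exceed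
  \<open>x c\<close>. So the ascent survives every step, and multiplying by
  \<open>simple_refl i\<close> shifts all lengths by the same amount.\<close>

lemma pieri_chain_ascent:
  assumes "pieri_chain n m u B x" "u permutes {1..n}" "i \<in> {1..<m}" "m < n" "u i < u (Suc i)"
  shows "x i < x (Suc i) \<and>
    pieri_chain n m (u \<circ> simple_refl i) (simple_refl i ` B) (x \<circ> simple_refl i)"
  using assms
proof (induction rule: pieri_chain.induct)
  case init
  then show ?case by (auto intro: pieri_chain.init)
next
  case (step B x b c)
  have x: "x permutes {1..n}" by (rule pieri_chain_permutes[OF step(1) step.prems(1)])
  have i: "i \<in> {1..<n}" using step.prems by auto
  note cov = pieri_step_cover[OF x step(2,4,5)]
  let ?y = "x \<circ> transpose b c"
  have xi: "x i < x (Suc i)" using step by blast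
  have c: "c \<noteq> i" "c \<noteq> Suc i" using step.hyps(4) step.prems(2) by auto
  have y: "?y i < ?y (Suc i)"
  proof -
    consider "b = i" | "b = Suc i" | "b \<noteq> i" "b \<noteq> Suc i" by blast
    then show ?thesis
    proof cases
      case 1
      then have "x (Suc i) < x b \<or> x c < x (Suc i)"
        using step.hyps(4) step.prems(2) by (intro cov(2)) auto
      then show ?thesis using 1 xi c by auto
    next
      case 2
      then show ?thesis using cov(1) xi c by auto
    next
      case 3
      then show ?thesis using xi c by simp
    qed
  qed
  have "inversions n (?y \<circ> simple_refl i) = inversions n (x \<circ> simple_refl i) + 1"
    using inversions_ascent[OF i y] inversions_ascent[OF i xi] step.hyps(5) by linarith
  then show ?case
    using y pieri_chain_conj_step[OF _ step.prems(2) step.hyps(2-4)] step by blast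
qed

text \<open>A descent can only be lost by raising position \<open>i + 1\<close> past position
  \<open>i\<close>. Afterwards \<open>i + 1\<close> cannot move again, and a move of
  \<open>i\<close> cannot overtake it, so the ascent is permanent. Hence a final descent at
  \<open>i\<close> guarantees that the whole chain conjugates.\<close>

lemma pieri_chain_descent:
  assumes "pieri_chain n m u B x" "u permutes {1..n}" "i \<in> {1..<m}" "m < n" "u (Suc i) < u i"
  shows "x (Suc i) < x i \<and>
      pieri_chain n m (u \<circ> simple_refl i) (simple_refl i ` B) (x \<circ> simple_refl i)
    \<or> x i < x (Suc i) \<and> Suc i \<in> B"
  using assms
proof (induction rule: pieri_chain.induct)
  case init
  then show ?case by (auto intro: pieri_chain.init)
next
  case (step B x b c)
  have x: "x permutes {1..n}" by (rule pieri_chain_permutes[OF step(1) step.prems(1)])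
  have i: "i \<in> {1..<n}" using step.prems by auto
  note cov = pieri_step_cover[OF x step(2,4,5)]
  let ?y = "x \<circ> transpose b c"
  have c: "c \<noteq> i" "c \<noteq> Suc i" using step.hyps(4) step.prems(2) by auto
  from step.IH[OF step.prems] show ?case
  proof
    assume A: "x (Suc i) < x i \<and>
      pieri_chain n m (u \<circ> simple_refl i) (simple_refl i ` B) (x \<circ> simple_refl i)"
    show ?thesis
    proof (cases "?y (Suc i) < ?y i")
      case y: True
      have "inversions n (?y \<circ> simple_refl i) = inversions n (x \<circ> simple_refl i) + 1"
        using inversions_descent[OF i y] inversions_descent[OF i, of x] A step.hyps(5) by linarith
      then show ?thesis
        using y A pieri_chain_conj_step[OF _ step.prems(2) step.hyps(2-4)] by blast
    next
      case False
      have "b = Suc i"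
      proof (rule ccontr)
        assume b: "b \<noteq> Suc i"
        have "x i \<le> ?y i" "?y (Suc i) = x (Suc i)"
          using b c cov(1) by (auto simp: transpose_def)
        then show False using A False by simp
      qed
      moreover have "?y permutes {1..n}"
        using step.hyps step.prems by (intro permutes_comp_transpose[OF x]) auto
      then have "?y i \<noteq> ?y (Suc i)" by (rule permutes_Suc_neq)
      ultimately show ?thesis using False by (metis insertI1 linorder_neqE_nat)
    qed
  next
    assume A: "x i < x (Suc i) \<and> Suc i \<in> B"
    then have b: "b \<noteq> Suc i" using step.hyps(3) by blast
    have "?y i < ?y (Suc i)"
    proof (cases "b = i")
      case True
      then have "x (Suc i) < x b \<or> x c < x (Suc i)"
        using step.hyps(4) step.prems(2) by (intro cov(2)) auto
      then show ?thesis using True A c by auto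
    next
      case False
      then show ?thesis using b c A by simp
    qed
    then show ?thesis using A by blast
  qed
qed

subsection \<open>Permutations increasing after position \<open>m\<close>\<close>

definition increasing_after :: "nat \<Rightarrow> nat \<Rightarrow> (nat \<Rightarrow> nat) \<Rightarrow> bool" where
  "increasing_after n m w \<longleftrightarrow> (\<forall>j\<in>{m<..<n}. w j < w (Suc j))"

lemma increasing_after_less:
  assumes "increasing_after n m w" "m < i" "i < j" "j \<le> n"
  shows "w i < w j"
  using increasing_imp_less[of "Suc m" n w i j] assms by (auto simp: increasing_after_def)

lemma perm_code_increasing_after:
  assumes "increasing_after n m w" "m < i"
  shows "perm_code n w i = 0"
proof -
  have "{j \<in> {i<..n}. w j < w i} = {}"
    using increasing_after_less[OF assms] by fastforce
  then show ?thesis by (simp add: perm_code_def)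
qed

text \<open>\<open>x c\<close> is the smallest value above \<open>x b\<close> after position \<open>m\<close>, so the exchange keeps the values
  there in order and changes the code at \<open>b\<close> only.\<close>

lemma cover_increasing_after:
  assumes x: "x permutes {1..n}" and inc: "increasing_after n m x"
    and b: "b \<in> {1..m}" and c: "c \<in> {m<..n}"
    and lt: "x b < x c" and nb: "\<And>k. b < k \<Longrightarrow> k < c \<Longrightarrow> x k < x b \<or> x c < x k"
  shows "increasing_after n m (x \<circ> transpose b c)"
    and "perm_code n (x \<circ> transpose b c) i = perm_code n x i + (if i = b then 1 else 0)"
proof -
  let ?y = "x \<circ> transpose b c"
  have yb: "?y b = x c" and yc: "?y c = x b" and yo: "j \<noteq> b \<Longrightarrow> j \<noteq> c \<Longrightarrow> ?y j = x j" for j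
    by auto
  show inc': "increasing_after n m ?y"
    unfolding increasing_after_def
  proof
    fix j assume j: "j \<in> {m<..<n}"
    then have jb: "j \<noteq> b" "Suc j \<noteq> b" using b by auto
    have xj: "x j < x (Suc j)" using inc j by (auto simp: increasing_after_def)
    consider "j = c" | "Suc j = c" | "j \<noteq> c" "Suc j \<noteq> c" by blast
    then show "?y j < ?y (Suc j)"
    proof cases
      case 1
      then have "?y (Suc j) = x (Suc j)" using jb by (intro yo) auto
      then show ?thesis using yc 1 xj lt by simp
    next
      case 2
      then have "?y j = x j" using jb by (intro yo) auto
      then show ?thesis using yc 2 xj nb[of j] j b by auto
    next
      case 3
      then show ?thesis using xj jb yo by simp
    qed
  qed
  consider "m < i" | "i = b" | "i < b" | "b < i" "i \<le> m" by linarith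
  then show "perm_code n ?y i = perm_code n x i + (if i = b then 1 else 0)"
  proof cases
    case 1
    then show ?thesis using perm_code_increasing_after inc inc' b by simp
  next
    case 2
    have "{j \<in> {b<..n}. ?y j < ?y b} = insert c {j \<in> {b<..n}. x j < x b}" (is "?A = ?B")
    proof (rule set_eqI)
      fix j
      show "j \<in> ?A \<longleftrightarrow> j \<in> ?B"
      proof (cases "j = c \<or> \<not> (b < j \<and> j \<le> n)")
        case True
        then show ?thesis using b c lt yb yc by auto
      next
        case False
        then have j: "b < j" "j \<le> n" "j \<noteq> c" by auto
        have "?y j = x j" using j yo by simp
        moreover have "x j < x c \<longleftrightarrow> x j < x b"
        proof (cases "j < c")
          case True
          then show ?thesis using nb[of j] j lt by auto
        next
          case False
          then have "x c < x j" using increasing_after_less[OF inc, of c j] j c by auto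
          then show ?thesis using lt by auto
        qed
        ultimately show ?thesis using j yb by auto
      qed
    qed
    moreover have "c \<notin> {j \<in> {b<..n}. x j < x b}" using lt by auto
    ultimately show ?thesis using 2 by (simp add: perm_code_def)
  next
    case 3
    have yi: "?y i = x i" using 3 b c by (intro yo) auto
    have "{j \<in> {i<..n}. ?y j < x i} = transpose b c ` {j \<in> {i<..n}. x j < x i}" (is "?A = _ ` ?B")
    proof (intro equalityI subsetI)
      fix k assume k: "k \<in> ?A"
      then have "transpose b c k \<in> ?B" using 3 b c by (auto simp: transpose_def split: if_splits)
      then show "k \<in> transpose b c ` ?B" by (metis imageI transpose_involutory)
    next
      fix k assume "k \<in> transpose b c ` ?B"
      then obtain l where "k = transpose b c l" "l \<in> ?B" by blast
      then show "k \<in> ?A" using 3 b c by (auto simp: transpose_def split: if_splits)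
    qed
    then have "card ?A = card ?B"
      using card_image[of "transpose b c" ?B] inj_on_subset[OF inj_transpose] by simp
    then show ?thesis using 3 yi by (simp only: perm_code_def) simp
  next
    case 4
    have yi: "?y i = x i" using 4 c by (intro yo) auto
    \<comment> \<open>The only later position whose value changes is \<open>c\<close>, from
      \<open>x c\<close> to \<open>x b\<close>, and the cover condition keeps \<open>x i\<close> out
      of that interval.\<close>
    have "{j \<in> {i<..n}. ?y j < x i} = {j \<in> {i<..n}. x j < x i}" (is "?A = ?B")
    proof (rule set_eqI)
      fix j
      show "j \<in> ?A \<longleftrightarrow> j \<in> ?B"
      proof (cases "j = c")
        case True
        then show ?thesis using nb[of i] 4 c lt yc by auto
      next
        case False
        then show ?thesis using yo[of j] 4 by auto
      qed
    qed
    then show ?thesis using 4 yi by (simp only: perm_code_def) simp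
  qed
qed

lemma pieri_chain_increasing_after:
  assumes "pieri_chain n m u B x" "u permutes {1..n}" "increasing_after n m u"
  shows "increasing_after n m x \<and>
    (\<forall>i. perm_code n x i = perm_code n u i + (if i \<in> B then 1 else 0))"
  using assms
proof (induction rule: pieri_chain.induct)
  case (step B x b c)
  have x: "x permutes {1..n}" by (rule pieri_chain_permutes[OF step(1) step.prems(1)])
  note cov = cover_increasing_after[OF x _ step.hyps(2,4) pieri_step_cover[OF x step.hyps(2,4,5)]]
  note IH = step.IH[OF step.prems]
  have "perm_code n (x \<circ> transpose b c) i = perm_code n u i + (if i \<in> insert b B then 1 else 0)" for i
    using IH cov(2)[of i] step.hyps(3) by auto
  then show ?case using IH cov(1) by blast
qed simp

text \<open>The local cover condition yields the length condition, since the code grows by one at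
  \<open>b\<close> only and its sum counts the inversions.\<close>

lemma pieri_chain_cover_step:
  assumes ch: "pieri_chain n m u B x" and u: "u permutes {1..n}" "increasing_after n m u"
    and b: "b \<in> {1..m}" "b \<notin> B" and c: "c \<in> {m<..n}"
    and lt: "x b < x c" and nb: "\<And>k. b < k \<Longrightarrow> k < c \<Longrightarrow> x k < x b \<or> x c < x k"
  shows "pieri_chain n m u (insert b B) (x \<circ> transpose b c)"
proof (rule pieri_chain.step[OF ch b c])
  have x: "x permutes {1..n}" by (rule pieri_chain_permutes[OF ch u(1)])
  have "increasing_after n m x" using pieri_chain_increasing_after[OF ch u] by blast
  note code = cover_increasing_after(2)[OF x this b(1) c lt nb]
  have "inversions n (x \<circ> transpose b c) = inversions n x + (\<Sum>i\<in>{1..n}. if i = b then 1 else 0)"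
    by (simp only: inversions_def code sum.distrib)
  then show "inversions n (x \<circ> transpose b c) = inversions n x + 1" using b c by simp
qed

lemma pieri_chain_unique:
  assumes "pieri_chain n m u B x" "pieri_chain n m u B y"
    and u: "u permutes {1..n}" "increasing_after n m u"
  shows "x = y"
proof (rule perm_code_inject)
  show "x permutes {1..n}" "y permutes {1..n}" using assms pieri_chain_permutes by blast+
  show "perm_code n x i = perm_code n y i" for i
    using pieri_chain_increasing_after[OF assms(1) u] pieri_chain_increasing_after[OF assms(2) u]
    by simp
qed

text \<open>The moved positions can be read off the codes, so different sets \<open>B\<close>
  contribute different permutations to the Pieri sum.\<close>

lemma pieri_chain_moved_unique:
  assumes "pieri_chain n m u B x" "pieri_chain n m u C x"
    and u: "u permutes {1..n}" "increasing_after n m u"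
  shows "B = C"
proof (rule set_eqI)
  fix i
  show "i \<in> B \<longleftrightarrow> i \<in> C"
    using pieri_chain_increasing_after[OF assms(1) u] pieri_chain_increasing_after[OF assms(2) u]
    by (metis add_left_cancel zero_neq_one)
qed

subsection \<open>The formula\<close>

definition pieri_set :: "nat \<Rightarrow> nat \<Rightarrow> nat \<Rightarrow> (nat \<Rightarrow> nat) \<Rightarrow> (nat \<Rightarrow> nat) set" where
  "pieri_set n m l u = {v. \<exists>B. pieri_chain n m u B v \<and> card B = l}"

lemma pieri_set_permutes: "u permutes {1..n} \<Longrightarrow> v \<in> pieri_set n m l u \<Longrightarrow> v permutes {1..n}"
  using pieri_chain_permutes by (auto simp: pieri_set_def)

lemma finite_pieri_set: "u permutes {1..n} \<Longrightarrow> finite (pieri_set n m l u)"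
  by (rule finite_subset[OF _ finite_permutations[of "{1..n}"]]) (use pieri_set_permutes in blast)+

text \<open>When \<open>u\<close> decreases up to position \<open>m\<close>, every set of positions can be moved, one position after
  the other from left to right.\<close>

lemma pieri_chain_exists_decreasing:
  assumes u: "u permutes {1..n}" "increasing_after n m u" and dec: "\<And>i. i \<in> {1..<m} \<Longrightarrow> u (Suc i) < u i"
    and un: "u n = n" and m: "m < n" and B: "B \<subseteq> {1..m}"
  shows "\<exists>v. pieri_chain n m u B v"
proof -
  \<comment> \<open>The bound by \<open>x n\<close> guarantees a larger value after position
    \<open>m\<close> for every position still to be moved; initially it comes from
    \<open>u n = n\<close>.\<close>
  have "j \<le> m \<Longrightarrow> \<exists>x. pieri_chain n m u (B \<inter> {1..j}) x \<and> (\<forall>i\<in>{j<..m}. x i = u i \<and> u i < x n)" for j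
  proof (induction j)
    case 0
    have "u i < n" if "i \<in> {1..m}" for i
      using permutes_in_image[OF u(1), of i] permutes_neq[OF u(1), of i n] that m un by auto
    then show ?case using un by (intro exI[of _ u]) (auto intro: pieri_chain.init)
  next
    case (Suc j)
    then obtain x where x: "pieri_chain n m u (B \<inter> {1..j}) x"
      "\<And>i. i \<in> {j<..m} \<Longrightarrow> x i = u i \<and> u i < x n" by auto
    show ?case
    proof (cases "Suc j \<in> B")
      case False
      then have "B \<inter> {1..Suc j} = B \<inter> {1..j}" by (auto simp: le_Suc_eq)
      then show ?thesis using x by (intro exI[of _ x]) auto
    next
      case True
      let ?b = "Suc j"
      \<comment> \<open>Minimality of \<open>c\<close> gives the cover condition to the right of
        \<open>m\<close>; up to \<open>m\<close> it holds because the later positions still carry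
        the smaller values of \<open>u\<close>.\<close>
      define c where "c = (LEAST c. m < c \<and> x ?b < x c)"
      have n: "m < n \<and> x ?b < x n" using x(2)[of ?b] Suc.prems m by auto
      then have c: "m < c \<and> x ?b < x c" unfolding c_def by (rule LeastI)
      have cn: "c \<le> n" unfolding c_def using n by (rule Least_le)
      have px: "x permutes {1..n}" by (rule pieri_chain_permutes[OF x(1) u(1)])
      have nb: "x k < x ?b \<or> x c < x k" if k: "?b < k" "k < c" for k
      proof (cases "k \<le> m")
        case True
        then show ?thesis
          using x(2)[of k] x(2)[of ?b] k Suc.prems decreasing_imp_less[of 1 m u ?b k, OF dec] by auto
      next
        case False
        then have "\<not> x ?b < x k" using k not_less_Least[of k "\<lambda>c. m < c \<and> x ?b < x c"]
          by (auto simp: c_def)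
        then show ?thesis using permutes_neq[OF px, of ?b k] k by linarith
      qed
      have "pieri_chain n m u (insert ?b (B \<inter> {1..j})) (x \<circ> transpose ?b c)"
        using c cn Suc.prems by (intro pieri_chain_cover_step[OF x(1) u _ _ _ _ nb]) auto
      moreover have "insert ?b (B \<inter> {1..j}) = B \<inter> {1..?b}" using True by (auto simp: le_Suc_eq)
      moreover have "(x \<circ> transpose ?b c) i = u i \<and> u i < (x \<circ> transpose ?b c) n"
        if i: "i \<in> {?b<..m}" for i
      proof
        show "(x \<circ> transpose ?b c) i = u i" using x(2)[of i] i c by (auto simp: transpose_def)
        \<comment> \<open>If \<open>c = n\<close>, position \<open>n\<close> receives the old value
          of \<open>?b\<close>, which still exceeds all values to be moved later.\<close>
        have "u i < u ?b" using i decreasing_imp_less[of 1 m u ?b i, OF dec] by auto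
        then show "u i < (x \<circ> transpose ?b c) n"
          using x(2)[of i] x(2)[of ?b] i m Suc.prems by (auto simp: transpose_def)
      qed
      ultimately show ?thesis by (metis (no_types, lifting))
    qed
  qed
  from this[of m] B show ?thesis by (auto simp: Int_absorb2)
qed

lemma pieri_decreasing:
  assumes u: "u permutes {1..n}" "increasing_after n m u" and dec: "\<And>i. i \<in> {1..<m} \<Longrightarrow> u (Suc i) < u i"
    and un: "u n = n" and m: "m < n"
  shows "schubert n u * elem_sym l m = (\<Sum>v\<in>pieri_set n m l u. schubert n v)"
proof -
  define S where "S = {J. J \<subseteq> {1..m} \<and> card J = l}"
  define V where "V = (\<lambda>B. SOME v. pieri_chain n m u B v)"
  have V: "pieri_chain n m u B (V B)" if "B \<in> S" for B
  proof -
    have "\<exists>v. pieri_chain n m u B v"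
      using that by (intro pieri_chain_exists_decreasing[OF assms]) (auto simp: S_def)
    then show ?thesis unfolding V_def by (rule someI_ex)
  qed
  have dominant: "schubert n v = (\<Prod>i\<in>{1..n}. var i ^ perm_code n v i)"
    if ch: "pieri_chain n m u B v" for B v
  proof (rule schubert_dominant)
    show "v permutes {1..n}" by (rule pieri_chain_permutes[OF ch u(1)])
    fix i assume i: "i \<in> {1..<n}"
    note code = pieri_chain_increasing_after[OF ch u]
    show "perm_code n v (Suc i) \<le> perm_code n v i"
    proof (cases "i < m")
      case True
      \<comment> \<open>The strict inequality absorbs the one that membership of
        \<open>Suc i\<close> in \<open>B\<close> may add.\<close>
      then have "perm_code n u (Suc i) < perm_code n u i" using perm_code_descent[OF i] dec i by simp
      then show ?thesis using code by simp
    next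
      case False
      then show ?thesis using perm_code_increasing_after[of n m v "Suc i"] code by simp
    qed
  qed
  have "schubert n (V B) = schubert n u * (\<Prod>b\<in>B. var b)" if B: "B \<in> S" for B
  proof -
    have "(\<Prod>b\<in>B. var b) = (\<Prod>i\<in>{1..n}. var i ^ (if i \<in> B then 1 else 0))"
      using B m by (intro prod.mono_neutral_cong_left) (auto simp: S_def)
    then show ?thesis
      unfolding dominant[OF V[OF B]] dominant[OF pieri_chain.init]
      using pieri_chain_increasing_after[OF V[OF B] u]
      by (simp only: power_add prod.distrib)
  qed
  moreover have "inj_on V S"
  proof (rule inj_onI)
    fix B C assume "B \<in> S" "C \<in> S" and eq: "V B = V C"
    then have "pieri_chain n m u B (V B)" "pieri_chain n m u C (V B)" using V by metis+
    then show "B = C" by (rule pieri_chain_moved_unique[OF _ _ u])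
  qed
  moreover have "pieri_set n m l u = V ` S"
  proof (intro equalityI subsetI)
    fix v assume "v \<in> pieri_set n m l u"
    then obtain B where B: "pieri_chain n m u B v" "card B = l" by (auto simp: pieri_set_def)
    then have "B \<in> S" using pieri_chain_subset by (auto simp: S_def)
    then show "v \<in> V ` S" using pieri_chain_unique[OF B(1) V[OF \<open>B \<in> S\<close>] u] by (rule image_eqI[rotated])
  next
    fix v assume "v \<in> V ` S"
    then show "v \<in> pieri_set n m l u" using V by (auto simp: S_def pieri_set_def)
  qed
  ultimately have "(\<Sum>v\<in>pieri_set n m l u. schubert n v) = (\<Sum>B\<in>S. schubert n u * (\<Prod>b\<in>B. var b))"
    by (simp only: sum.reindex o_def cong: sum.cong)
  then show ?thesis by (simp add: elem_sym_def S_def sum_distrib_left)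
qed

lemma swap_vars_elem_sym:
  assumes i: "i \<in> {1..<m}"
  shows "swap_vars i (elem_sym l m) = elem_sym l m"
proof -
  let ?t = "transpose i (i + 1)"
  let ?S = "{J. J \<subseteq> {1..m} \<and> card J = l}"
  have t: "?t permutes {1..m}" using i by (intro permutes_swap_id) auto
  have img: "?t ` J \<in> ?S" if "J \<in> ?S" for J
    using that permutes_image[OF t] card_image[of ?t J] inj_on_subset[OF inj_transpose]
    by (metis (no_types, lifting) image_mono mem_Collect_eq subset_UNIV)
  have "swap_vars i (elem_sym l m) = (\<Sum>J\<in>?S. \<Prod>j\<in>J. var (?t j))"
    by (simp add: elem_sym_def swap_vars_sum swap_vars_prod)
  also have "\<dots> = (\<Sum>J\<in>?S. \<Prod>j\<in>?t ` J. var j)"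
    using prod.reindex[of ?t _ var] inj_on_subset[OF inj_transpose] by (simp add: o_def)
  also have "\<dots> = (\<Sum>J\<in>?S. \<Prod>j\<in>J. var j)"
    by (rule sum.reindex_bij_witness[of _ "image ?t" "image ?t"])
      (use img in \<open>simp_all add: image_image\<close>)
  finally show ?thesis by (simp add: elem_sym_def)
qed

lemma card_simple_refl_image [simp]: "card (simple_refl i ` B) = card B"
  by (simp add: card_image)

lemma pieri:
  assumes "u permutes {1..n}" "increasing_after n m u" "u n = n" "m < n"
  shows "schubert n u * elem_sym l m = (\<Sum>v\<in>pieri_set n m l u. schubert n v)"
  using assms
proof (induction u rule: permutes_ascent_induct)
  case (step u)
  note u = step(1) and inc = step.prems(1) and un = step.prems(2) and m = step.prems(3)
  show ?case
  proof (cases "\<forall>i\<in>{1..<m}. u (Suc i) < u i")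
    case True
    then show ?thesis using pieri_decreasing[OF u inc _ un m] by blast
  next
    case False
    then obtain i where i: "i \<in> {1..<m}" "\<not> u (Suc i) < u i" by blast
    then have asc: "u i < u (Suc i)" using permutes_Suc_neq[OF u, of i] by linarith
    have i': "i \<in> {1..<n}" using i m by auto
    let ?s = "simple_refl i"
    let ?v = "u \<circ> ?s"
    have v: "?v permutes {1..n}" by (rule permutes_comp_simple_refl[OF u i'])
    have vdesc: "?v (Suc i) < ?v i" using asc by simp
    have "increasing_after n m ?v"
      using inc i by (auto simp: increasing_after_def)
    moreover have "?v n = n" using un i m by simp
    moreover have "inversions n u < inversions n ?v" using inversions_ascent[OF i' asc] by simp
    ultimately have IH: "schubert n ?v * elem_sym l m = (\<Sum>x\<in>pieri_set n m l ?v. schubert n x)"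
      using step(2)[OF v] m by blast
    \<comment> \<open>The endpoints that survive the divided difference. By
      \<open>pieri_chain_ascent\<close> and \<open>pieri_chain_descent\<close>, multiplying by
      \<open>?s\<close> matches them with the endpoints above \<open>u\<close>.\<close>
    let ?D = "{x \<in> pieri_set n m l ?v. x (Suc i) < x i}"
    have set: "pieri_set n m l u = (\<lambda>x. x \<circ> ?s) ` ?D"
    proof (intro equalityI subsetI)
      fix x assume "x \<in> pieri_set n m l u"
      then obtain B where B: "pieri_chain n m u B x" "card B = l" by (auto simp: pieri_set_def)
      have "x i < x (Suc i)" "pieri_chain n m ?v (?s ` B) (x \<circ> ?s)"
        using pieri_chain_ascent[OF B(1) u i(1) m asc] by auto
      then have "x \<circ> ?s \<in> ?D" using B(2) by (auto simp: pieri_set_def intro!: exI[of _ "?s ` B"])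
      then show "x \<in> (\<lambda>x. x \<circ> ?s) ` ?D" by (metis (no_types, lifting) comp_simple_refl_twice imageI)
    next
      fix y assume "y \<in> (\<lambda>x. x \<circ> ?s) ` ?D"
      then obtain x B where x: "y = x \<circ> ?s" "x (Suc i) < x i" "pieri_chain n m ?v B x" "card B = l"
        by (auto simp: pieri_set_def)
      then have "pieri_chain n m u (?s ` B) y"
        using pieri_chain_descent[OF x(3) v i(1) m vdesc] unfolding comp_simple_refl_twice by auto
      then show "y \<in> pieri_set n m l u"
        using x(4) unfolding pieri_set_def by (auto intro!: exI[of _ "?s ` B"])
    qed
    have inj: "inj_on (\<lambda>x. x \<circ> ?s) ?D" by (metis (no_types, lifting) comp_simple_refl_twice inj_onI)
    have "schubert n u = divided_diff i (schubert n ?v)"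
      using divided_diff_schubert_descent[OF v i' vdesc, symmetric] unfolding comp_simple_refl_twice .
    then have "schubert n u * elem_sym l m = divided_diff i (schubert n ?v * elem_sym l m)"
      using divided_diff_mult_symmetric[OF swap_vars_elem_sym[OF i(1)]] by simp
    also have "\<dots> = (\<Sum>x\<in>pieri_set n m l ?v. divided_diff i (schubert n x))"
      by (simp add: IH divided_diff_sum)
    also have "\<dots> = (\<Sum>x\<in>?D. schubert n (x \<circ> ?s))"
    proof (rule sum.mono_neutral_cong_right)
      show "\<forall>x\<in>pieri_set n m l ?v - ?D. divided_diff i (schubert n x) = 0"
      proof
        fix x assume x: "x \<in> pieri_set n m l ?v - ?D"
        then have "x permutes {1..n}" using pieri_set_permutes[OF v] by blast
        moreover have "x i < x (Suc i)" using x permutes_Suc_neq[OF calculation, of i] by auto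
        ultimately show "divided_diff i (schubert n x) = 0"
          using divided_diff_schubert_ascent i' by blast
      qed
      show "divided_diff i (schubert n x) = schubert n (x \<circ> ?s)" if "x \<in> ?D" for x
        using that divided_diff_schubert_descent[OF _ i'] pieri_set_permutes[OF v] by blast
    qed (use finite_pieri_set[OF v] in auto)
    also have "\<dots> = (\<Sum>x\<in>pieri_set n m l u. schubert n x)"
      unfolding set by (simp add: sum.reindex[OF inj])
    finally show ?thesis .
  qed
qed

section \<open>The labels\<close>

lemma label_perm_apply:
  assumes "r \<le> m"
  shows "label_perm r m i = (if i = Suc m then r else if i \<in> {r..m} then Suc i else i)"
  using assms
proof (induction m arbitrary: i rule: dec_induct)
  case base
  have "label_perm r r = simple_refl r"
    using word_perm_snoc[of "[]" r] by (simp add: label_perm_def)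
  then show ?case by (simp add: simple_refl_def transpose_def)
next
  case (step m)
  have "label_perm r (Suc m) = label_perm r m \<circ> simple_refl (Suc m)"
    using step(1) word_perm_snoc[of "[r..<Suc m]" "Suc m"] by (simp add: label_perm_def)
  then have "label_perm r (Suc m) i = label_perm r m (simple_refl (Suc m) i)" by simp
  also have "\<dots> = (if i = Suc (Suc m) then r else if i \<in> {r..Suc m} then Suc i else i)"
    unfolding step.IH using step(1) by (auto simp: simple_refl_def transpose_def)
  finally show ?case .
qed

text \<open>\<open>arrow\<close> only sees the permutation and quantifies over its endpoints, which
  must be recovered as the ends of the interval of non-fixed points.\<close>

lemma label_perm_inject:
  assumes "r \<le> m" "r' \<le> m'" and eq: "label_perm r m = label_perm r' m'"
  shows "r = r' \<and> m = m'"
proof -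
  have "{i. label_perm r m i \<noteq> i} = {r..Suc m}" if "r \<le> m" for r m
    using that by (auto simp: label_perm_apply)
  then have "{r..Suc m} = {r'..Suc m'}" using assms by metis
  then show ?thesis using assms(1,2) by (simp add: Icc_eq_Icc)
qed

lemma label_perm_permutes:
  assumes "1 \<le> r" "r \<le> m" "m < n"
  shows "label_perm r m permutes {1..n}"
  unfolding label_perm_def using assms inversions_word_perm[of "[r..<Suc m]" n] by auto

lemma transp_chain_cong:
  "(\<And>j. j \<in> {1..i} \<Longrightarrow> b j = b' j \<and> c j = c' j) \<Longrightarrow> transp_chain u b c i = transp_chain u b' c' i"
  by (induction i) auto

text \<open>Translates the inductive chains into the indexed sequences of \<open>arrow\<close>; a
  further step is stored at index \<open>card B + 1\<close>.\<close>

lemma pieri_chain_transp_chain: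
  "pieri_chain n m u B v \<Longrightarrow> \<exists>b c. inj_on b {1..card B} \<and> b ` {1..card B} = B \<and>
    (\<forall>i\<in>{1..card B}. c i \<in> {m<..n}) \<and> v = transp_chain u b c (card B) \<and>
    (\<forall>i\<in>{1..card B}. inversions n (transp_chain u b c i) = inversions n u + i)"
proof (induction rule: pieri_chain.induct)
  case init
  then show ?case by simp
next
  case (step B x b0 c0)
  then obtain b c where bc: "inj_on b {1..card B}" "b ` {1..card B} = B"
    "\<forall>i\<in>{1..card B}. c i \<in> {m<..n}" "x = transp_chain u b c (card B)"
    "\<forall>i\<in>{1..card B}. inversions n (transp_chain u b c i) = inversions n u + i"
    by (elim exE conjE) (rule that)
  let ?l = "Suc (card B)"
  have card: "card (insert b0 B) = ?l" using step(3) pieri_chain_finite[OF step(1)] by simp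
  let ?b = "b(?l := b0)" and ?c = "c(?l := c0)"
  have int: "{1..?l} = insert ?l {1..card B}" by auto
  have img: "?b ` {1..card B} = B" using bc(2) by auto
  have "inj_on ?b {1..card B} \<longleftrightarrow> inj_on b {1..card B}" by (rule inj_on_cong) auto
  then have "inj_on ?b {1..?l}"
    unfolding int inj_on_insert using bc(1) img step(3) by (simp del: fun_upd_image)
  moreover have "?b ` {1..?l} = insert b0 B" unfolding int image_insert img by simp
  moreover have "\<forall>i\<in>{1..?l}. ?c i \<in> {m<..n}" using bc(3) step(4) by auto
  moreover have same: "transp_chain u ?b ?c i = transp_chain u b c i" if "i \<le> card B" for i
    using that by (intro transp_chain_cong) auto
  then have last: "x \<circ> transpose b0 c0 = transp_chain u ?b ?c ?l" using bc(4) by simp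
  moreover have "\<forall>i\<in>{1..?l}. inversions n (transp_chain u ?b ?c i) = inversions n u + i"
  proof
    fix i assume i: "i \<in> {1..?l}"
    show "inversions n (transp_chain u ?b ?c i) = inversions n u + i"
    proof (cases "i = ?l")
      case True
      then show ?thesis
        using step(5) pieri_chain_inversions[OF step(1)] unfolding True last[symmetric] by linarith
    next
      case False
      then show ?thesis using i same[of i] bc(5) by auto
    qed
  qed
  ultimately show ?case unfolding card by (intro exI[of _ ?b] exI[of _ ?c] conjI)
qed

lemma transp_chain_pieri_chain:
  assumes u: "u permutes {1..n}" and m: "m < n"
    and bc: "\<And>i. i \<in> {1..l} \<Longrightarrow> b i \<in> {1..m} \<and> c i \<in> {m<..n}"
    and len: "\<And>i. i \<in> {1..l} \<Longrightarrow> cox_length n (transp_chain u b c i) = cox_length n u + i"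
    and inj: "inj_on b {1..l}"
  shows "i \<le> l \<Longrightarrow> pieri_chain n m u (b ` {1..i}) (transp_chain u b c i)"
proof (induction i)
  case 0
  then show ?case by (simp add: pieri_chain.init)
next
  case (Suc i)
  let ?x = "transp_chain u b c i" and ?y = "transp_chain u b c (Suc i)"
  have ch: "pieri_chain n m u (b ` {1..i}) ?x" using Suc by simp
  have b: "b (Suc i) \<in> {1..m}" and c: "c (Suc i) \<in> {m<..n}" using bc[of "Suc i"] Suc.prems by auto
  have nb: "b (Suc i) \<notin> b ` {1..i}"
  proof
    assume "b (Suc i) \<in> b ` {1..i}"
    then obtain j where j: "j \<in> {1..i}" "b (Suc i) = b j" by blast
    have "Suc i = j" by (rule inj_onD[OF inj j(2)]) (use j(1) Suc.prems in auto)
    then show False using j(1) by simp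
  qed
  have x: "?x permutes {1..n}" by (rule pieri_chain_permutes[OF ch u])
  have y: "?y permutes {1..n}"
    unfolding transp_chain.simps using b c m by (intro permutes_comp_transpose[OF x]) auto
  have "cox_length n ?x = cox_length n u + i"
    using len[of i] Suc.prems by (cases "i = 0") auto
  moreover have "cox_length n ?y = cox_length n u + Suc i" using len[of "Suc i"] Suc.prems by auto
  ultimately have "inversions n ?y = inversions n ?x + 1"
    unfolding cox_length_eq_inversions[OF x] cox_length_eq_inversions[OF y] by linarith
  then have "pieri_chain n m u (insert (b (Suc i)) (b ` {1..i})) ?y"
    unfolding transp_chain.simps by (intro pieri_chain.step[OF ch b nb c])
  moreover have "insert (b (Suc i)) (b ` {1..i}) = b ` {1..Suc i}"
    by (simp add: atLeastAtMostSuc_conv)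
  ultimately show ?case by metis
qed

lemma arrow_label_perm_iff:
  assumes u: "u permutes {1..n}" and r: "1 \<le> r" "r \<le> m" "m < n"
  shows "arrow n (label_perm r m) u v \<longleftrightarrow> v \<in> pieri_set n m (m + 1 - r) u"
proof
  assume "arrow n (label_perm r m) u v"
  then obtain r' m' l b c where a: "1 \<le> r'" "r' \<le> m'" "m' < n" "label_perm r m = label_perm r' m'"
    "l = m' - r' + 1" "\<forall>i\<in>{1..l}. b i \<in> {1..n} \<and> c i \<in> {1..n} \<and> b i \<le> m' \<and> m' < c i"
    "v = transp_chain u b c l"
    "\<forall>i\<in>{1..l}. cox_length n (transp_chain u b c i) = cox_length n u + i" "inj_on b {1..l}"
    unfolding arrow_def by blast
  have e: "r' = r" "m' = m" using label_perm_inject[OF r(2) a(2,4)] by auto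
  have "pieri_chain n m u (b ` {1..l}) v"
    unfolding a(7) using a e by (intro transp_chain_pieri_chain[OF u r(3)]) auto
  moreover have "card (b ` {1..l}) = m + 1 - r" using a(5,9) e r by (simp add: card_image)
  ultimately show "v \<in> pieri_set n m (m + 1 - r) u" by (auto simp: pieri_set_def)
next
  assume "v \<in> pieri_set n m (m + 1 - r) u"
  then obtain B where B: "pieri_chain n m u B v" "card B = m + 1 - r" by (auto simp: pieri_set_def)
  define l where "l = m - r + 1"
  have l: "card B = l" using B(2) r by (simp add: l_def)
  from pieri_chain_transp_chain[OF B(1)] obtain b c where bc: "inj_on b {1..l}" "b ` {1..l} = B"
    "\<And>i. i\<in>{1..l} \<Longrightarrow> c i \<in> {m<..n}" "v = transp_chain u b c l"
    "\<And>i. i\<in>{1..l} \<Longrightarrow> inversions n (transp_chain u b c i) = inversions n u + i"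
    unfolding l by blast
  have b: "b i \<in> {1..m}" if "i \<in> {1..l}" for i
    using that bc(2) pieri_chain_subset[OF B(1)] by blast
  have "transp_chain u b c i permutes {1..n}" if "i \<le> l" for i
    using that
  proof (induction i)
    case 0
    show ?case using u by (simp only: transp_chain.simps)
  next
    case (Suc i)
    then have "transp_chain u b c i permutes {1..n}" by simp
    then show ?case unfolding transp_chain.simps
      by (rule permutes_comp_transpose) (use b[of "Suc i"] bc(3)[of "Suc i"] Suc.prems r in auto)
  qed
  then have "\<forall>i\<in>{1..l}. cox_length n (transp_chain u b c i) = cox_length n u + i"
    using bc(5) cox_length_eq_inversions u by simp
  moreover have "\<forall>i\<in>{1..l}. b i \<in> {1..n} \<and> c i \<in> {1..n} \<and> b i \<le> m \<and> m < c i"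
  proof
    fix i assume i: "i \<in> {1..l}"
    show "b i \<in> {1..n} \<and> c i \<in> {1..n} \<and> b i \<le> m \<and> m < c i" using b[OF i] bc(3)[OF i] r by auto
  qed
  ultimately show "arrow n (label_perm r m) u v"
    unfolding arrow_def using bc(1,4) r l_def by blast
qed

section \<open>One step of the recursion\<close>

lemma increasing_after_le:
  assumes w: "w permutes {1..n}" and inc: "increasing_after n m w" and i: "m < i"
  shows "w i \<le> i"
proof (cases "i \<le> n")
  case True
  then show ?thesis
    using i
  proof (induction i rule: inc_induct)
    case base
    show ?case
    proof (cases "n = 0")
      case True
      then show ?thesis using w by simp
    next
      case False
      then show ?thesis using permutes_in_image[OF w, of n] by simp
    qed
  next
    case (step j)
    then have "w j < w (Suc j)" using inc by (auto simp: increasing_after_def)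
    then show ?case using step by simp
  qed
qed (use permutes_not_in[OF w] in simp)

text \<open>Each of the \<open>w i - 1\<close> smaller values stands either at one of the
  \<open>i - 1\<close> earlier positions or at a later one counted by the code.\<close>

lemma permutes_le_perm_code:
  assumes w: "w permutes {1..n}" and i: "i \<in> {1..n}"
  shows "w i \<le> i + perm_code n w i"
proof -
  have "{1..<w i} \<subseteq> w ` ({1..<i} \<union> {j \<in> {i<..n}. w j < w i})"
  proof
    fix y assume y: "y \<in> {1..<w i}"
    have "w i \<in> {1..n}" using permutes_in_image[OF w] i by blast
    then have "y \<in> {1..n}" using y by auto
    then obtain j where j: "j \<in> {1..n}" "y = w j" using permutes_image[OF w] by blast
    then have "j \<noteq> i" using y by auto
    then have "j \<in> {1..<i} \<union> {j \<in> {i<..n}. w j < w i}" using j y by auto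
    then show "y \<in> w ` ({1..<i} \<union> {j \<in> {i<..n}. w j < w i})" using j(2) by blast
  qed
  then have "card {1..<w i} \<le> card ({1..<i} \<union> {j \<in> {i<..n}. w j < w i})"
    by (rule surj_card_le[rotated]) simp
  also have "\<dots> \<le> card {1..<i} + perm_code n w i" unfolding perm_code_def by (rule card_Un_le)
  finally have "w i - 1 \<le> (i - 1) + perm_code n w i" by simp
  moreover have "1 \<le> i" using i by simp
  ultimately show ?thesis by linarith
qed

text \<open>Up to \<open>m\<close> the code depends on the prefix only, and after \<open>m\<close>
  it vanishes.\<close>

lemma permutes_eq_increasing_after:
  assumes x: "x permutes {1..n}" "increasing_after n m x"
    and w: "w permutes {1..n}" "increasing_after n m w"
    and eq: "\<And>i. i \<in> {1..m} \<Longrightarrow> x i = w i"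
  shows "x = w"
proof (rule perm_code_inject[OF x(1) w(1)])
  fix i assume i: "i \<in> {1..n}"
  show "perm_code n x i = perm_code n w i"
  proof (cases "i \<le> m")
    case True
    then have "x ` {1..<i} = w ` {1..<i}" "x i = w i" using eq i by (auto intro!: image_cong)
    then show ?thesis using perm_code_eq_unused[OF x(1) i] perm_code_eq_unused[OF w(1) i] by simp
  next
    case False
    then show ?thesis using perm_code_increasing_after x(2) w(2) by simp
  qed
qed

text \<open>\<open>rec_perm\<close> with the cut position as a parameter, so that one step can be
  studied apart from the choice of \<open>p\<close>.\<close>

definition reduce :: "nat \<Rightarrow> (nat \<Rightarrow> nat) \<Rightarrow> nat \<Rightarrow> nat" where
  "reduce m w i = (if i \<le> m then (if w i < w (m + 1) then w i else w i - 1) else w (i + 1) - 1)"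

lemma rec_perm_eq_reduce: "rec_perm k a w = reduce (a (max_index k a w)) w"
  by (simp add: rec_perm_def reduce_def Let_def fun_eq_iff)

locale reduction =
  fixes n m r :: nat and w u :: "nat \<Rightarrow> nat"
  assumes w: "w permutes {1..n}" and inc: "increasing_after n m w" and m: "0 < m" "m < n"
    and nonfix: "w (m + 1) \<noteq> m + 1" and r_def: "r = w (m + 1)" and u_def: "u = reduce m w"
begin

lemma r_bounds: "1 \<le> r" "r \<le> m"
proof -
  have "m + 1 \<in> {1..n}" using m by simp
  then have "r \<in> {1..n}" unfolding r_def using permutes_in_image[OF w] by blast
  then show "1 \<le> r" by simp
  have "r \<le> m + 1" unfolding r_def by (rule increasing_after_le[OF w inc]) simp
  then show "r \<le> m" using nonfix by (simp add: r_def)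
qed

lemma right_gt: "m + 1 < i \<Longrightarrow> r < w i"
proof (cases "i \<le> n")
  case True
  assume "m + 1 < i"
  then show ?thesis unfolding r_def using True by (intro increasing_after_less[OF inc]) auto
next
  case False
  then have "w i = i" using permutes_not_in[OF w] by simp
  then show ?thesis using False r_bounds m by simp
qed

lemma w_neq_r: "i \<noteq> m + 1 \<Longrightarrow> w i \<noteq> r"
  unfolding r_def by (rule permutes_neq[OF w])

text \<open>\<open>u\<close> arises from \<open>w\<close> by deleting position \<open>m + 1\<close> and its value \<open>r\<close>.\<close>

lemma u_eq_delete:
  "u i = (let x = w (if i \<le> m then i else i + 1) in if x < r then x else x - 1)"
  using right_gt[of "i + 1"] by (auto simp: u_def reduce_def r_def Let_def)

lemma u_left: "i \<le> m \<Longrightarrow> u i = (if w i < r then w i else w i - 1)"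
  by (simp add: u_eq_delete)

lemma u_right: "m < i \<Longrightarrow> u i = w (i + 1) - 1"
  by (simp add: u_def reduce_def)

lemma u_permutes: "u permutes {1..n}"
proof (rule bij_imp_permutes)
  \<comment> \<open>Closing the gap at \<open>r\<close> is injective on the remaining
    values.\<close>
  have mono: "(if x < r then x else x - 1) = (if y < r then y else y - 1) \<Longrightarrow> x = y"
    if "x \<noteq> r" "y \<noteq> r" for x y using that r_bounds by (auto split: if_splits)
  have inj: "inj u"
  proof (rule injI)
    fix i j assume "u i = u j"
    then have "w (if i \<le> m then i else i + 1) = w (if j \<le> m then j else j + 1)"
      unfolding u_eq_delete Let_def by (rule mono[rotated 2]) (auto intro!: w_neq_r)
    then have "(if i \<le> m then i else i + 1) = (if j \<le> m then j else j + 1)"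
      by (rule injD[OF permutes_inj[OF w]])
    then show "i = j" by (auto split: if_splits)
  qed
  have out: "u i = i" if i: "i \<notin> {1..n}" for i
  proof (cases "i = 0")
    case True
    then show ?thesis using permutes_not_in[OF w, of 0] r_bounds by (simp add: u_left)
  next
    case False
    then show ?thesis using permutes_not_in[OF w, of "i + 1"] i m by (simp add: u_right)
  qed
  have "u ` {1..n} \<subseteq> {1..n}"
  proof
    fix y assume "y \<in> u ` {1..n}"
    then obtain i where i: "i \<in> {1..n}" "y = u i" by blast
    show "y \<in> {1..n}"
    proof (rule ccontr)
      assume "y \<notin> {1..n}"
      then have "u y = y" by (rule out)
      then have "y = i" using inj i(2) by (metis injD)
      then show False using i \<open>y \<notin> {1..n}\<close> by blast
    qed
  qed
  then show "bij_betw u {1..n} {1..n}"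
    using inj_on_subset[OF inj] endo_inj_surj[of "{1..n}" u] by (simp add: bij_betw_def)
  show "\<And>x. x \<notin> {1..n} \<Longrightarrow> u x = x" by (rule out)
qed

lemma u_last: "u n = n"
  using m permutes_not_in[OF w, of "n + 1"] by (simp add: u_right)

lemma u_increasing_after: "increasing_after n m u"
  unfolding increasing_after_def
proof
  fix j assume j: "j \<in> {m<..<n}"
  \<comment> \<open>The shift reaches position \<open>n + 1\<close>, where the convention
    \<open>w (n + 1) = n + 1\<close> takes over.\<close>
  have "w (j + 1) < w (j + 2)"
  proof (cases "j + 1 = n")
    case True
    have "w (j + 1) \<in> {1..n}" using permutes_in_image[OF w, of "j + 1"] j by auto
    then show ?thesis using permutes_not_in[OF w, of "j + 2"] True by simp
  next
    case False
    then show ?thesis using j inc by (auto simp: increasing_after_def)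
  qed
  moreover have "r < w (j + 1)" using right_gt j by simp
  ultimately show "u j < u (Suc j)" using j by (simp add: u_right)
qed

lemma u_ascent: "i < m \<Longrightarrow> w i < w (Suc i) \<Longrightarrow> u i < u (Suc i)"
  using w_neq_r[of i] w_neq_r[of "Suc i"] by (auto simp: u_left)

text \<open>The deletion shifts the fixed tail one position to the left, so \<open>M\<close> itself
  becomes fixed. This is the strict decrease behind termination.\<close>

lemma u_fixed:
  assumes "\<And>i. M < i \<Longrightarrow> w i = i" "m < M" "M \<le> i"
  shows "u i = i"
  using assms by (simp add: u_right)

definition moved :: "nat set" where
  "moved = {i \<in> {1..m}. r \<le> u i}"

lemma small_left:
  assumes "w i < r"
  shows "i \<le> m"
proof (rule ccontr)
  assume "\<not> i \<le> m"
  then show False using right_gt[of i] assms by (cases "i = m + 1") (auto simp: r_def)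
qed

lemma moved_eq: "moved = {1..m} - {i \<in> {1..m}. w i < r}"
proof (rule set_eqI)
  fix i
  show "i \<in> moved \<longleftrightarrow> i \<in> {1..m} - {i \<in> {1..m}. w i < r}"
    using u_left[of i] w_neq_r[of i] by (auto simp: moved_def)
qed

text \<open>From position \<open>m + 1\<close> on, all values are at least \<open>r\<close>, so the
  \<open>r - 1\<close> smaller ones stand at positions up to \<open>m\<close>.\<close>

lemma card_moved: "card moved = m + 1 - r"
proof -
  have "w ` {i \<in> {1..m}. w i < r} = {1..<r}"
  proof (intro equalityI subsetI)
    fix y assume "y \<in> w ` {i \<in> {1..m}. w i < r}"
    then obtain i where i: "i \<in> {1..m}" "w i < r" "y = w i" by blast
    then have "i \<in> {1..n}" using m by simp
    then have "w i \<in> {1..n}" using permutes_in_image[OF w] by blast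
    then show "y \<in> {1..<r}" using i by simp
  next
    fix y assume y: "y \<in> {1..<r}"
    then have "y \<in> {1..n}" using r_bounds m by simp
    then obtain i where i: "i \<in> {1..n}" "y = w i" using permutes_image[OF w] by blast
    then have "i \<le> m" using small_left y by simp
    then show "y \<in> w ` {i \<in> {1..m}. w i < r}" using i y by auto
  qed
  moreover have "inj_on w {i \<in> {1..m}. w i < r}"
    by (rule inj_on_subset[OF permutes_inj[OF w]]) simp
  ultimately have "card {i \<in> {1..m}. w i < r} = r - 1"
    using card_image[of w "{i \<in> {1..m}. w i < r}"] by simp
  then have "card moved = m - (r - 1)"
    unfolding moved_eq by (subst card_Diff_subset) auto
  then show ?thesis using r_bounds by simp
qed

text \<open>The chain from \<open>u\<close> to \<open>w\<close> raises the values \<open>h \<ge> r\<close> left of position \<open>m + 1\<close> by one, in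
  decreasing order; consecutive values always give a cover.\<close>

lemma pieri_chain_moved: "pieri_chain n m u moved w"
proof -
  have "1 \<le> h \<Longrightarrow> h \<le> n \<Longrightarrow> \<exists>x. pieri_chain n m u {i \<in> {1..m}. h \<le> u i} x \<and>
      (\<forall>i\<in>{1..m}. x i = (if h \<le> u i then u i + 1 else u i))" for h
  proof (induction "n - h" arbitrary: h)
    case 0
    have "u i < n" if "i \<in> {1..m}" for i
      using permutes_in_image[OF u_permutes, of i] permutes_neq[OF u_permutes, of i n] that m u_last
      by auto
    then have none: "\<forall>i\<in>{1..m}. \<not> h \<le> u i" using 0 by fastforce
    then have "{i \<in> {1..m}. h \<le> u i} = {}" by blast
    then have "pieri_chain n m u {i \<in> {1..m}. h \<le> u i} u" by (simp only: pieri_chain.init)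
    then show ?case using none by (intro exI[of _ u] conjI) simp_all
  next
    case (Suc d)
    then have "d = n - Suc h" "1 \<le> Suc h" "Suc h \<le> n" by auto
    from Suc.hyps(1)[OF this] obtain x where x: "pieri_chain n m u {i \<in> {1..m}. Suc h \<le> u i} x"
      "\<And>i. i\<in>{1..m} \<Longrightarrow> x i = (if Suc h \<le> u i then u i + 1 else u i)"
      by blast
    have px: "x permutes {1..n}" by (rule pieri_chain_permutes[OF x(1) u_permutes])
    show ?case
    proof (cases "\<exists>b\<in>{1..m}. u b = h")
      case False
      then have "{i \<in> {1..m}. h \<le> u i} = {i \<in> {1..m}. Suc h \<le> u i}" by (auto simp: le_less Suc_le_eq)
      moreover have "x i = (if h \<le> u i then u i + 1 else u i)" if "i \<in> {1..m}" for i
        using x(2)[OF that] False that by (auto simp: le_less Suc_le_eq)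
      ultimately show ?thesis using x(1) by metis
    next
      case True
      then obtain b where b: "b \<in> {1..m}" "u b = h" by blast
      then have xb: "x b = h" using x(2)[of b] by simp
      \<comment> \<open>The partner of \<open>b\<close> is the position of the value
        \<open>h + 1\<close>. Up to \<open>m\<close> the values of \<open>x\<close> are at most
        \<open>h\<close> or at least \<open>h + 2\<close>, so this position lies after
        \<open>m\<close>.\<close>
      have "Suc h \<in> {1..n}" using Suc by simp
      then obtain c where c: "c \<in> {1..n}" "x c = Suc h" using permutes_image[OF px] by (metis imageE)
      have "\<not> c \<le> m"
      proof
        assume "c \<le> m"
        then show False using x(2)[of c] c by (auto split: if_splits)
      qed
      then have cm: "c \<in> {m<..n}" using c by simp
      have "x k < x b \<or> x c < x k" if "b < k" "k < c" for k
        using permutes_neq[OF px, of k b] permutes_neq[OF px, of k c] that xb c by auto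
      then have "pieri_chain n m u (insert b {i \<in> {1..m}. Suc h \<le> u i}) (x \<circ> transpose b c)"
        using b xb c cm
        by (intro pieri_chain_cover_step[OF x(1) u_permutes u_increasing_after]) auto
      moreover have "insert b {i \<in> {1..m}. Suc h \<le> u i} = {i \<in> {1..m}. h \<le> u i}"
        using b permutes_neq[OF u_permutes] by (auto simp: le_less Suc_le_eq)
      moreover have "(x \<circ> transpose b c) i = (if h \<le> u i then u i + 1 else u i)"
        if i: "i \<in> {1..m}" for i
      proof (cases "i = b")
        case True
        then show ?thesis using b c by simp
      next
        case False
        then have "u i \<noteq> h" using permutes_neq[OF u_permutes False] b by simp
        then show ?thesis using x(2)[OF i] False i cm by (auto simp: transpose_def)
      qed
      ultimately show ?thesis by metis
    qed
  qed
  from this[of r] r_bounds m obtain x where x: "pieri_chain n m u moved x"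
    "\<And>i. i\<in>{1..m} \<Longrightarrow> x i = (if r \<le> u i then u i + 1 else u i)" unfolding moved_def by auto
  have "x = w"
  proof (rule permutes_eq_increasing_after[OF _ _ w inc])
    show "x permutes {1..n}" by (rule pieri_chain_permutes[OF x(1) u_permutes])
    show "increasing_after n m x"
      using pieri_chain_increasing_after[OF x(1) u_permutes u_increasing_after] by blast
    fix i assume i: "i \<in> {1..m}"
    show "x i = w i" using x(2)[OF i] w_neq_r[of i] u_left[of i] i by (auto split: if_splits)
  qed
  then show ?thesis using x(1) by simp
qed

lemma w_in_pieri_set: "w \<in> pieri_set n m (m + 1 - r) u"
  using pieri_chain_moved card_moved by (auto simp: pieri_set_def)

text \<open>Position \<open>m + 1\<close> holds the least value after \<open>m\<close>. An exchange
  never raises it and leaves a larger value at \<open>b\<close>.\<close>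

lemma pieri_chain_values:
  assumes "pieri_chain n m u B x"
  shows "(\<forall>b\<in>B. x (m + 1) < x b) \<and> (\<forall>i\<in>{1..m} - B. x i = u i)"
  using assms
proof (induction rule: pieri_chain.induct)
  case (step B x b c)
  have x: "x permutes {1..n}" by (rule pieri_chain_permutes[OF step(1) u_permutes])
  have inc: "increasing_after n m x"
    using pieri_chain_increasing_after[OF step(1) u_permutes u_increasing_after] by blast
  have lt: "x b < x c" by (rule pieri_step_cover[OF x step.hyps(2,4,5)])
  have first: "x (m + 1) \<le> x c"
    using increasing_after_less[OF inc, of "m + 1" c] step.hyps(4) by (cases "c = m + 1") auto
  have y: "(x \<circ> transpose b c) (m + 1) = (if c = m + 1 then x b else x (m + 1))"
    using step.hyps(2) by (auto simp: transpose_def)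
  have "(x \<circ> transpose b c) (m + 1) < (x \<circ> transpose b c) b'" if b': "b' \<in> insert b B" for b'
  proof (cases "b' = b")
    case True
    have "c \<noteq> m + 1 \<Longrightarrow> x (m + 1) < x c"
      using first permutes_neq[OF x, of "m + 1" c] by simp
    then show ?thesis unfolding y using True lt by auto
  next
    case False
    then have b': "b' \<in> B" "b' \<le> m" using b' pieri_chain_subset[OF step(1)] by auto
    then have "(x \<circ> transpose b c) b' = x b'" using False step.hyps(4) by (auto simp: transpose_def)
    moreover have "x (m + 1) < x b'" using step.IH b' by blast
    ultimately show ?thesis unfolding y using lt by auto
  qed
  moreover have "(x \<circ> transpose b c) i = u i" if "i \<in> {1..m} - insert b B" for i
    using that step.IH step.hyps(4) by (auto simp: transpose_def)
  ultimately show ?case by blast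
qed simp

text \<open>All values below \<open>v (m + 1)\<close> stand at the \<open>r - 1\<close> unmoved
  positions, so \<open>v (m + 1)\<close> is at most \<open>r\<close>. Equality would give these
  positions exactly the values below \<open>r\<close>, unchanged from \<open>u\<close>; then
  \<open>B\<close> would be \<open>moved\<close> and \<open>v\<close> would be
  \<open>w\<close>.\<close>

lemma pieri_set_first_less:
  assumes v: "v \<in> pieri_set n m (m + 1 - r) u" "v \<noteq> w"
  shows "v (m + 1) < r"
proof -
  obtain B where B: "pieri_chain n m u B v" "card B = m + 1 - r"
    using v(1) by (auto simp: pieri_set_def)
  let ?s = "v (m + 1)" and ?C = "{1..m} - B"
  have pv: "v permutes {1..n}" by (rule pieri_chain_permutes[OF B(1) u_permutes])
  have inc_v: "increasing_after n m v"
    using pieri_chain_increasing_after[OF B(1) u_permutes u_increasing_after] by blast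
  note vals = pieri_chain_values[OF B(1)]
  have Bm: "B \<subseteq> {1..m}" by (rule pieri_chain_subset[OF B(1)])
  have card_C: "card ?C = r - 1"
    using Bm B(2) r_bounds by (simp add: card_Diff_subset pieri_chain_finite[OF B(1)])
  have sub: "{1..<?s} \<subseteq> v ` ?C"
  proof
    fix y assume y: "y \<in> {1..<?s}"
    have "?s \<in> {1..n}" using permutes_in_image[OF pv, of "m + 1"] m by simp
    then have "y \<in> {1..n}" using y by simp
    then obtain i where i: "i \<in> {1..n}" "y = v i" using permutes_image[OF pv] by blast
    have "i \<le> m"
    proof (rule ccontr)
      assume "\<not> i \<le> m"
      then have "?s \<le> v i"
        using increasing_after_less[OF inc_v, of "m + 1" i] i by (cases "i = m + 1") auto
      then show False using y i by simp
    qed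
    moreover have "i \<notin> B" using vals y i by auto
    ultimately show "y \<in> v ` ?C" using i by auto
  qed
  have card_img: "card (v ` ?C) = r - 1"
    using card_C card_image[of v ?C] inj_on_subset[OF permutes_inj[OF pv]] by auto
  have le: "?s \<le> r"
    using card_mono[OF _ sub] card_img r_bounds by simp
  have "?s \<noteq> r"
  proof
    assume s: "?s = r"
    have eq: "{1..<r} = v ` ?C"
      using card_subset_eq[OF _ sub] card_img s by simp
    have "u i < r" if "i \<in> ?C" for i
      using that vals eq by (metis atLeastLessThan_iff imageI)
    then have "moved \<subseteq> B" by (auto simp: moved_def not_le[symmetric])
    then have "moved = B"
      using card_subset_eq[OF pieri_chain_finite[OF B(1)]] B(2) card_moved by simp
    then have "v = w"
      using pieri_chain_unique[OF B(1) _ u_permutes u_increasing_after] pieri_chain_moved by simp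
    then show False using v(2) by simp
  qed
  then show ?thesis using le by simp
qed

text \<open>\<open>u\<close> already fixes \<open>M\<close>, so its code at \<open>i\<close> up to
  \<open>m\<close> is at most \<open>M - 1 - i\<close>, which leaves room for the one added by a
  move. Thus \<open>v\<close> preserves the positions up to \<open>M\<close>, and beyond them it is
  increasing.\<close>

lemma pieri_set_fixed:
  assumes v: "v \<in> pieri_set n m l u" and fixed: "\<And>i. M < i \<Longrightarrow> w i = i" and M: "m < M" "M \<le> n"
    and j: "M < j"
  shows "v j = j"
proof -
  obtain B where B: "pieri_chain n m u B v" using v by (auto simp: pieri_set_def)
  have pv: "v permutes {1..n}" by (rule pieri_chain_permutes[OF B(1) u_permutes])
  have inc_v: "increasing_after n m v" and code: "\<And>i. perm_code n v i = perm_code n u i + (if i \<in> B then 1 else 0)"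
    using pieri_chain_increasing_after[OF B(1) u_permutes u_increasing_after] by auto
  have u_fix: "u i = i" if "M \<le> i" for i using u_fixed[OF fixed M(1) that] by simp
  have small: "v i \<le> M" if i: "i \<in> {1..M}" for i
  proof -
    have "perm_code n v i \<le> M - i"
    proof (cases "i \<le> m")
      case True
      have "u i < M"
      proof (rule ccontr)
        assume "\<not> u i < M"
        then have "u (u i) = u i" by (intro u_fix) simp
        then have "u i = i" using permutes_neq[OF u_permutes] by blast
        then show False using \<open>\<not> u i < M\<close> True M by simp
      qed
      then have "{j \<in> {i<..n}. u j < u i} \<subseteq> {i<..<M}"
        using u_fix by (auto simp: not_less) (metis less_trans not_less)
      then have "perm_code n u i \<le> card {i<..<M}"
        unfolding perm_code_def by (intro card_mono) auto
      then show ?thesis using code[of i] True M by (cases "i \<in> B") auto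
    next
      case False
      then show ?thesis using perm_code_increasing_after[OF inc_v] by simp
    qed
    moreover have "v i \<le> i + perm_code n v i"
      using i M by (intro permutes_le_perm_code[OF pv]) auto
    moreover have "i \<le> M" using i by simp
    ultimately show ?thesis by linarith
  qed
  have "v ` {1..M} \<subseteq> {1..M}"
  proof
    fix y assume "y \<in> v ` {1..M}"
    then obtain i where i: "i \<in> {1..M}" "y = v i" by blast
    then have "v i \<in> {1..n}" using permutes_in_image[OF pv, of i] M by simp
    then show "y \<in> {1..M}" using small[OF i(1)] i(2) by simp
  qed
  then have img: "v ` {1..M} = {1..M}"
    using inj_on_subset[OF permutes_inj[OF pv]] by (intro endo_inj_surj) auto
  have "j \<le> n \<Longrightarrow> j \<le> v j"
    using Suc_leI[OF j]
  proof (induction j rule: dec_induct)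
    case base
    have "v (Suc M) \<notin> v ` {1..M}" using permutes_inj[OF pv] by (simp add: inj_image_mem_iff)
    moreover have "v (Suc M) \<in> {1..n}" using permutes_in_image[OF pv, of "Suc M"] base by simp
    ultimately show ?case unfolding img by simp
  next
    case (step j)
    then have "v j < v (Suc j)" using inc_v M by (auto simp: increasing_after_def)
    then show ?case using step by simp
  qed
  moreover have "v j \<le> j" using increasing_after_le[OF pv inc_v] j M by simp
  ultimately show ?thesis using permutes_not_in[OF pv, of j] by fastforce
qed

end

section \<open>The recursion\<close>

locale descent_positions =
  fixes n k :: nat and a :: "nat \<Rightarrow> nat"
  assumes strict_mono: "strict_mono_on {1..k} a"
    and bounds: "\<And>j. j \<in> {1..k} \<Longrightarrow> 0 < a j \<and> a j < n"
    and first: "a 0 = 0" and last: "a (k + 1) = n"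
begin

lemma a_less:
  assumes "1 \<le> i" "i < j" "j \<le> k + 1"
  shows "a i < a j"
proof (cases "j = k + 1")
  case True
  then show ?thesis using bounds[of i] assms last by simp
next
  case False
  then show ?thesis using strict_mono_onD[OF strict_mono, of i j] assms by simp
qed

lemma a_le:
  assumes "i \<le> j" "j \<le> k + 1"
  shows "a i \<le> a j"
  using assms first a_less[of i j] by (cases "i = 0 \<or> i = j") auto

lemma a_le_n: "i \<le> k + 1 \<Longrightarrow> a i \<le> n"
  using a_le[of i "k + 1"] last by simp

lemma a_inject: "i \<in> {1..k} \<Longrightarrow> j \<in> {1..k} \<Longrightarrow> a i = a j \<longleftrightarrow> i = j"
  using a_less[of i j] a_less[of j i] by (cases i j rule: linorder_cases) auto

lemma interior_not_position:
  assumes "q \<le> k" "a q < i" "i < a (q + 1)"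
  shows "i \<notin> a ` {1..k}"
proof
  assume "i \<in> a ` {1..k}"
  then obtain j where j: "j \<in> {1..k}" "i = a j" by blast
  show False
    using a_le[of j q] a_le[of "q + 1" j] assms j by (cases "j \<le> q") auto
qed

lemma descent_perms_ascent:
  assumes "w \<in> descent_perms n k a" "i \<in> {1..<n}" "i \<notin> a ` {1..k}"
  shows "w i < w (Suc i)"
  using assms permutes_Suc_neq[of w "{1..n}" i] by (force simp: descent_perms_def)

lemma descent_perms_permutes: "w \<in> descent_perms n k a \<Longrightarrow> w permutes {1..n}"
  by (simp add: descent_perms_def)

lemma increasing_after_block:
  assumes w: "w \<in> descent_perms n k a" and q: "q \<le> k" and fixed: "\<And>i. a (q + 1) < i \<Longrightarrow> w i = i"
  shows "increasing_after n (a q) w"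
  unfolding increasing_after_def
proof
  fix j assume j: "j \<in> {a q<..<n}"
  consider "j < a (q + 1)" | "j = a (q + 1)" | "a (q + 1) < j" by linarith
  then show "w j < w (Suc j)"
  proof cases
    case 1
    then show ?thesis using interior_not_position[OF q] j by (intro descent_perms_ascent[OF w]) auto
  next
    case 2
    \<comment> \<open>A value beyond \<open>j\<close> is fixed by \<open>w\<close>, so it would be
      taken twice.\<close>
    have "\<not> j < w j"
    proof
      assume "j < w j"
      then have "w (w j) = w j" using fixed 2 by simp
      then have "w j = j" using permutes_neq[OF descent_perms_permutes[OF w]] by blast
      then show False using \<open>j < w j\<close> by simp
    qed
    then show ?thesis using fixed[of "Suc j"] 2 by simp
  next
    case 3
    then show ?thesis using fixed by simp
  qed
qed

text \<open>Downward induction over the blocks: \<open>w\<close> increases on a block whose first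
  position is fixed, so \<open>w i\<close> is at least \<open>i\<close>, and
  \<open>increasing_after_le\<close> gives the other bound. The case \<open>q = 0\<close> shows that
  \<open>max_index\<close> exists unless \<open>w = id\<close>.\<close>

lemma fixed_above:
  assumes w: "w \<in> descent_perms n k a" and q: "q \<le> k + 1"
    and fixed: "\<And>j. q \<le> j \<Longrightarrow> j \<le> k \<Longrightarrow> w (a j + 1) = a j + 1"
  shows "a q < i \<Longrightarrow> w i = i"
  using q fixed
proof (induction q arbitrary: i rule: inc_induct)
  case base
  then show ?case using permutes_not_in[OF descent_perms_permutes[OF w], of i] last by simp
next
  case (step q)
  have above: "w i = i" if "a (q + 1) < i" for i
    using step.IH[of i] step.prems that by simp
  have inc: "increasing_after n (a q) w"
    using step.hyps by (intro increasing_after_block[OF w _ above]) auto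
  show ?case
  proof (cases "i \<le> n")
    case True
    have "Suc (a q) \<le> i" using step.prems by simp
    then have "i \<le> n \<Longrightarrow> i \<le> w i"
    proof (induction i rule: dec_induct)
      case base
      then show ?case using step.prems(2)[of q] step.hyps by simp
    next
      case (step j)
      then have "w j < w (Suc j)" using inc by (auto simp: increasing_after_def)
      then show ?case using step by simp
    qed
    moreover have "w i \<le> i"
      using increasing_after_le[OF descent_perms_permutes[OF w] inc] step.prems by simp
    ultimately show ?thesis using True by simp
  next
    case False
    then show ?thesis using permutes_not_in[OF descent_perms_permutes[OF w], of i] by simp
  qed
qed

lemma max_index_props:
  assumes w: "w \<in> descent_perms n k a" "w \<noteq> id"
  shows "max_index k a w \<le> k \<and> w (a (max_index k a w) + 1) \<noteq> a (max_index k a w) + 1"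
    and "q \<in> {max_index k a w<..k} \<Longrightarrow> w (a q + 1) = a q + 1"
proof -
  let ?P = "\<lambda>p. p \<le> k \<and> w (a p + 1) \<noteq> a p + 1"
  have "\<exists>p. ?P p"
  proof (rule ccontr)
    assume none: "\<nexists>p. ?P p"
    have "w i = i" for i
    proof (cases "i = 0")
      case True
      then show ?thesis using permutes_not_in[OF descent_perms_permutes[OF w(1)], of 0] by simp
    next
      case False
      then show ?thesis using fixed_above[OF w(1), of 0 i] none first by simp
    qed
    then show False using w(2) by auto
  qed
  then show "?P (max_index k a w)"
    unfolding max_index_def by (rule GreatestI_ex_nat[where b = k]) simp
  show "w (a q + 1) = a q + 1" if q: "q \<in> {max_index k a w<..k}"
  proof (rule ccontr)
    assume "w (a q + 1) \<noteq> a q + 1"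
    then have "?P q" using q by simp
    then have "q \<le> max_index k a w"
      unfolding max_index_def by (rule Greatest_le_nat[where b = k]) simp
    then show False using q by simp
  qed
qed

lemma max_index_eqI:
  assumes "p \<le> k" "w (a p + 1) \<noteq> a p + 1" "\<And>q. q \<in> {p<..k} \<Longrightarrow> w (a q + 1) = a q + 1"
  shows "max_index k a w = p"
  unfolding max_index_def
proof (rule Greatest_equality)
  show "p \<le> k \<and> w (a p + 1) \<noteq> a p + 1" using assms by simp
  fix q assume "q \<le> k \<and> w (a q + 1) \<noteq> a q + 1"
  then show "q \<le> p" using assms(3)[of q] by (meson greaterThanAtMost_iff not_le)
qed

end

text \<open>The largest non-fixed position, as a least bound so that it also makes sense for the
  identity, where it is 0.\<close>

definition last_moved :: "(nat \<Rightarrow> nat) \<Rightarrow> nat" where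
  "last_moved w = (LEAST M. \<forall>i>M. w i = i)"

lemma last_moved_le: "(\<And>i. M < i \<Longrightarrow> w i = i) \<Longrightarrow> last_moved w \<le> M"
  unfolding last_moved_def by (rule Least_le) simp

lemma last_moved_fixed:
  assumes "w permutes {1..n}" "last_moved w < i"
  shows "w i = i"
proof -
  have "\<forall>i>n. w i = i" using permutes_not_in[OF assms(1)] by simp
  then have "\<forall>i>last_moved w. w i = i" unfolding last_moved_def by (rule LeastI)
  then show ?thesis using assms(2) by simp
qed

locale recursion_step = descent_positions +
  fixes w u :: "nat \<Rightarrow> nat" and p m r :: nat
  assumes w_mem: "w \<in> descent_perms n k a" "w \<noteq> id"
    and p_eq: "p = max_index k a w" and m_eq: "m = a p" and r_eq: "r = w (m + 1)"
    and u_eq: "u = rec_perm k a w"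
begin

lemma p_le: "p \<le> k" and nonfixed: "w (m + 1) \<noteq> m + 1"
  using max_index_props(1)[OF w_mem] by (auto simp: p_eq m_eq)

lemma fixed_positions: "q \<in> {p<..k} \<Longrightarrow> w (a q + 1) = a q + 1"
  using max_index_props(2)[OF w_mem] by (simp add: p_eq)

lemma w_permutes: "w permutes {1..n}"
  by (rule descent_perms_permutes[OF w_mem(1)])

lemma w_fixed: "a (p + 1) < i \<Longrightarrow> w i = i"
  using fixed_above[OF w_mem(1), of "p + 1" i] fixed_positions p_le by simp

lemma w_increasing: "increasing_after n m w"
  unfolding m_eq by (rule increasing_after_block[OF w_mem(1) p_le w_fixed])

text \<open>\<open>max_index\<close> may range over 0 as well, but then \<open>w\<close> would
  increase throughout, which forces \<open>w 1 = 1\<close>.\<close>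

lemma p_pos: "1 \<le> p"
proof (rule ccontr)
  assume "\<not> 1 \<le> p"
  then have "p = 0" by simp
  then have m0: "m = 0" using first by (simp add: m_eq)
  have "w 1 \<le> 1" using increasing_after_le[OF w_permutes w_increasing, of 1] m0 by simp
  moreover have "w 1 \<noteq> 0"
    using permutes_neq[OF w_permutes, of 1 0] permutes_not_in[OF w_permutes, of 0] by simp
  ultimately show False using nonfixed m0 by simp
qed

lemma m_bounds: "0 < m" "m < n"
  using bounds[of p] p_pos p_le by (simp_all add: m_eq)

sublocale reduction n m r w u
  by unfold_locales
    (use w_permutes w_increasing m_bounds nonfixed in \<open>simp_all add: r_eq u_eq rec_perm_eq_reduce p_eq m_eq\<close>)

lemma label_eq: "rec_label k a w = label_perm r m"
  by (simp add: rec_label_def Let_def p_eq m_eq r_eq)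

lemma rec_others_eq: "rec_others n k a w = pieri_set n m (m + 1 - r) u - {w}"
  using arrow_label_perm_iff[OF u_permutes r_bounds m_bounds(2)]
  by (auto simp: rec_others_def label_eq u_eq)

lemma finite_rec_others: "finite (rec_others n k a w)"
  unfolding rec_others_eq using finite_pieri_set[OF u_permutes] by simp

lemma schubert_recursion:
  "schubert n w = schubert n u * elem_sym (m + 1 - r) m - (\<Sum>v\<in>rec_others n k a w. schubert n v)"
proof -
  have "(\<Sum>v\<in>pieri_set n m (m + 1 - r) u. schubert n v)
      = schubert n w + (\<Sum>v\<in>rec_others n k a w. schubert n v)"
    unfolding rec_others_eq by (rule sum.remove[OF finite_pieri_set[OF u_permutes] w_in_pieri_set])
  then show ?thesis
    using pieri[OF u_permutes u_increasing_after u_last m_bounds(2)] by simp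
qed

lemma m_position: "m \<in> a ` {1..k}"
  using p_pos p_le by (simp add: m_eq)

lemma u_in_descent_perms: "u \<in> descent_perms n k a"
proof -
  have "u i < u (Suc i)" if i: "i \<in> {1..<n}" "i \<notin> a ` {1..k}" for i
  proof -
    have "i \<noteq> m" using i m_position by blast
    then consider "i < m" | "m < i" by linarith
    then show ?thesis
    proof cases
      case 1
      then show ?thesis using descent_perms_ascent[OF w_mem(1) i] by (intro u_ascent)
    next
      case 2
      then show ?thesis using u_increasing_after i by (simp add: increasing_after_def)
    qed
  qed
  then show ?thesis using u_permutes by (fastforce simp: descent_perms_def)
qed

lemma label_in_descent_perms: "rec_label k a w \<in> descent_perms n k a"
proof -
  have "label_perm r m i < label_perm r m (Suc i)" if "i \<noteq> m" for i
    using that r_bounds by (auto simp: label_perm_apply)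
  then have "{i \<in> {1..<n}. label_perm r m i > label_perm r m (i + 1)} \<subseteq> {m}"
    by fastforce
  then show ?thesis
    using label_perm_permutes[OF r_bounds m_bounds(2)] m_position
    unfolding label_eq descent_perms_def by blast
qed

lemma pieri_set_descent_perms:
  assumes v: "v \<in> pieri_set n m l u"
  shows "v \<in> descent_perms n k a"
proof -
  obtain B where B: "pieri_chain n m u B v" using v by (auto simp: pieri_set_def)
  have v_inc: "increasing_after n m v"
    using pieri_chain_increasing_after[OF B u_permutes u_increasing_after] by blast
  have "v i < v (Suc i)" if i: "i \<in> {1..<n}" "i \<notin> a ` {1..k}" for i
  proof -
    have "i \<noteq> m" using i m_position by blast
    then consider "i < m" | "m < i" by linarith
    then show ?thesis
    proof cases
      case 1
      then show ?thesis
        using pieri_chain_ascent[OF B u_permutes _ m_bounds(2)]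
          descent_perms_ascent[OF u_in_descent_perms i] i by simp
    next
      case 2
      then show ?thesis using v_inc i by (simp add: increasing_after_def)
    qed
  qed
  then show ?thesis using pieri_set_permutes[OF u_permutes v] by (fastforce simp: descent_perms_def)
qed

lemma rec_others_descent_perms: "v \<in> rec_others n k a w \<Longrightarrow> v \<in> descent_perms n k a"
  using pieri_set_descent_perms by (auto simp: rec_others_eq)

lemma last_moved_bounds: "m < last_moved w" "last_moved w \<le> a (p + 1)" "last_moved w \<le> n"
proof -
  show "m < last_moved w"
    using last_moved_fixed[OF w_permutes, of "m + 1"] nonfixed by (cases "last_moved w < m + 1") auto
  show "last_moved w \<le> a (p + 1)" using w_fixed by (rule last_moved_le)
  then show "last_moved w \<le> n" using a_le_n[of "p + 1"] p_le by simp
qed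

lemma last_moved_u: "last_moved u < last_moved w"
proof -
  have "last_moved u \<le> last_moved w - 1"
    using u_fixed[OF last_moved_fixed[OF w_permutes] last_moved_bounds(1)] by (intro last_moved_le) simp
  then show ?thesis using last_moved_bounds(1) by simp
qed

lemma last_moved_others: "v \<in> rec_others n k a w \<Longrightarrow> last_moved v \<le> last_moved w"
  unfolding rec_others_eq
  using pieri_set_fixed[OF _ last_moved_fixed[OF w_permutes] last_moved_bounds(1,3)]
  by (intro last_moved_le) blast

text \<open>The termination measure of \<open>v\<close> uses the index chosen for \<open>v\<close>.
  It is again \<open>p\<close>, because \<open>v (m + 1) < r\<close> is not fixed while the later
  positions remain fixed.\<close>

lemma first_value_others:
  assumes v: "v \<in> rec_others n k a w"
  shows "v (a (max_index k a v) + 1) < r"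
proof -
  have less: "v (m + 1) < r" using v pieri_set_first_less by (auto simp: rec_others_eq)
  have "max_index k a v = p"
  proof (rule max_index_eqI[OF p_le])
    show "v (a p + 1) \<noteq> a p + 1" using less r_bounds unfolding m_eq by linarith
    fix q assume q: "q \<in> {p<..k}"
    have "last_moved v \<le> a q"
      using last_moved_others[OF v] last_moved_bounds(2) a_le[of "p + 1" q] q by simp
    moreover have "v permutes {1..n}"
      by (rule descent_perms_permutes[OF rec_others_descent_perms[OF v]])
    ultimately show "v (a q + 1) = a q + 1" using last_moved_fixed by simp
  qed
  then show ?thesis using less by (simp add: m_eq)
qed

end

context descent_positions
begin

lemma recursion_step:
  "w \<in> descent_perms n k a \<Longrightarrow> w \<noteq> id \<Longrightarrow>
   recursion_step n k a w (rec_perm k a w) (max_index k a w) (a (max_index k a w))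
     (w (a (max_index k a w) + 1))"
  by unfold_locales simp_all

lemma rec_call_descent_perms:
  assumes "rec_call n k a v w"
  shows "v \<in> descent_perms n k a"
proof -
  interpret recursion_step n k a w "rec_perm k a w" "max_index k a w" "a (max_index k a w)"
    "w (a (max_index k a w) + 1)"
    using assms by (intro recursion_step) (simp_all add: rec_call_def)
  show ?thesis
    using assms u_in_descent_perms rec_others_descent_perms by (auto simp: rec_call_def)
qed

lemma wfp_rec_call: "wfp (rec_call n k a)"
proof -
  let ?R = "measures [last_moved, \<lambda>w. w (a (max_index k a w) + 1)]"
  have "(v, w) \<in> ?R" if "rec_call n k a v w" for v w
  proof -
    interpret recursion_step n k a w "rec_perm k a w" "max_index k a w" "a (max_index k a w)"
      "w (a (max_index k a w) + 1)"
      using that by (intro recursion_step) (simp_all add: rec_call_def)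
    show ?thesis
      using that last_moved_u last_moved_others[of v] first_value_others[of v]
      by (auto simp: rec_call_def)
  qed
  then have "{(v, w). rec_call n k a v w} \<subseteq> ?R" by auto
  then show ?thesis unfolding wfp_def by (rule wf_subset[OF wf_measures])
qed

lemma expansion_exists: "w \<in> descent_perms n k a \<Longrightarrow> \<exists>F. expansion n k a w F"
proof (induction w rule: wfp_induct_rule[OF wfp_rec_call])
  case (1 w)
  show ?case
  proof (cases "w = id")
    case True
    then show ?thesis using expansion.identity by blast
  next
    case False
    have IH: "\<exists>F. expansion n k a v F" if "rec_call n k a v w" for v
      using 1 that rec_call_descent_perms by blast
    obtain F where F: "expansion n k a (rec_perm k a w) F"
      using IH[of "rec_perm k a w"] 1 False by (auto simp: rec_call_def)
    have "\<forall>v\<in>rec_others n k a w. \<exists>G. expansion n k a v G"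
      using IH 1 False by (simp add: rec_call_def)
    then obtain G where "\<And>v. v \<in> rec_others n k a w \<Longrightarrow> expansion n k a v (G v)" by metis
    then show ?thesis using expansion.recurse[OF 1(2) False refl F] by blast
  qed
qed

lemma expansion_unique: "expansion n k a w F \<Longrightarrow> expansion n k a w F' \<Longrightarrow> F = F'"
proof (induction arbitrary: F' rule: expansion.induct)
  case identity
  then show ?case by cases auto
next
  case (recurse w m F G)
  from recurse.prems show ?case
  proof cases
    case identity
    then show ?thesis using recurse.hyps by simp
  next
    case (recurse m' H K)
    have "F = H" using recurse.IH(1) recurse by blast
    \<comment> \<open>The rule constrains \<open>G\<close> on \<open>rec_others\<close> only, so
      only the sums can be compared.\<close>
    moreover have "(\<Sum>v\<in>rec_others n k a w. G v) = (\<Sum>v\<in>rec_others n k a w. K v)"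
      using recurse.IH(2) recurse by (intro sum.cong) auto
    ultimately show ?thesis using recurse recurse.hyps by simp
  qed
qed

end

subsection \<open>Expanded expressions\<close>

definition monomial_value :: "(nat \<times> nat) multiset \<Rightarrow> int_mpoly" where
  "monomial_value M = (\<Prod>(i, m)\<in>#M. elem_sym i m)"

definition expr_value :: "formal_expr \<Rightarrow> int_mpoly" where
  "expr_value F = (\<Sum>(c, M)\<in>#F. of_int c * monomial_value M)"

lemma expr_value_empty [simp]: "expr_value {#} = 0"
  by (simp add: expr_value_def)

lemma expr_value_add_mset [simp]:
  "expr_value (add_mset (c, M) F) = of_int c * monomial_value M + expr_value F"
  by (simp add: expr_value_def)

lemma expr_value_plus: "expr_value (F + G) = expr_value F + expr_value G"
  by (simp add: expr_value_def)

lemma expr_value_sum: "expr_value (\<Sum>v\<in>A. G v) = (\<Sum>v\<in>A. expr_value (G v))"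
  by (induction A rule: infinite_finite_induct) (simp_all add: expr_value_plus)

lemma expr_value_times:
  "expr_value (image_mset (\<lambda>(c, M). (c, add_mset (i, m) M)) F) = expr_value F * elem_sym i m"
  by (induction F) (auto simp: monomial_value_def algebra_simps)

lemma expr_value_uminus: "expr_value (image_mset (\<lambda>(c, M). (- c, M)) F) = - expr_value F"
  by (induction F) auto

context descent_positions
begin

text \<open>The bound \<open>t\<close>, later \<open>last_moved w\<close>, makes the count
  inductive: level \<open>a q\<close> may use only the places of its block below \<open>t\<close>.
  Truncated subtraction allows none when \<open>t\<close> is at most \<open>a q\<close>.\<close>

definition admissible :: "nat \<Rightarrow> (nat \<times> nat) multiset \<Rightarrow> bool" where
  "admissible t M \<longleftrightarrow>
    (\<forall>x\<in>#M. \<exists>q\<in>{1..k}. snd x = a q \<and> 0 < fst x \<and> fst x \<le> a q) \<and>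
    (\<forall>q\<in>{1..k}. size {#x \<in># M. snd x = a q#} \<le> min (a (q + 1)) t - a q)"

lemma admissible_mono:
  assumes "admissible s M" "s \<le> t"
  shows "admissible t M"
proof -
  have "min (a (q + 1)) s - a q \<le> min (a (q + 1)) t - a q" for q using assms(2) by auto
  then show ?thesis using assms(1) unfolding admissible_def by (meson le_trans)
qed

lemma expansion_value:
  "expansion n k a w F \<Longrightarrow> w \<in> descent_perms n k a \<Longrightarrow>
   schubert n w = expr_value F \<and> (\<forall>x\<in>#F. admissible (last_moved w) (snd x))"
proof (induction rule: expansion.induct)
  case identity
  show ?case unfolding schubert_id by (simp add: monomial_value_def admissible_def)
next
  case (recurse w m F G)
  interpret recursion_step n k a w "rec_perm k a w" "max_index k a w" m "w (m + 1)"
    using recursion_step recurse.hyps by simp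
  let ?u = "rec_perm k a w" and ?R = "rec_others n k a w"
  have F: "schubert n ?u = expr_value F" "\<And>x. x \<in># F \<Longrightarrow> admissible (last_moved ?u) (snd x)"
    using recurse.IH(1) u_in_descent_perms by auto
  have G: "schubert n v = expr_value (G v)" "\<And>x. x \<in># G v \<Longrightarrow> admissible (last_moved v) (snd x)"
    if "v \<in> ?R" for v
    using recurse.IH(2)[OF that] rec_others_descent_perms[OF that] by auto
  have "schubert n w = expr_value F * elem_sym (m + 1 - w (m + 1)) m - (\<Sum>v\<in>?R. expr_value (G v))"
    using schubert_recursion F(1) G(1) by simp
  moreover have "admissible (last_moved w) (add_mset (m + 1 - w (m + 1), m) M)"
    if M: "admissible (last_moved ?u) M" for M
    unfolding admissible_def
  proof (intro conjI ballI)
    fix x assume "x \<in># add_mset (m + 1 - w (m + 1), m) M"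
    then consider "x = (m + 1 - w (m + 1), m)" | "x \<in># M" by auto
    then show "\<exists>q\<in>{1..k}. snd x = a q \<and> 0 < fst x \<and> fst x \<le> a q"
    proof cases
      case 1
      then show ?thesis
        using p_pos p_le r_bounds by (intro bexI[of _ "max_index k a w"]) (auto simp: m_eq)
    next
      case 2
      then show ?thesis using M by (simp add: admissible_def)
    qed
  next
    fix q assume q: "q \<in> {1..k}"
    have bound: "size {#x \<in># M. snd x = a q#} \<le> min (a (q + 1)) (last_moved ?u) - a q"
      using M q by (simp add: admissible_def)
    show "size {#x \<in># add_mset (m + 1 - w (m + 1), m) M. snd x = a q#}
        \<le> min (a (q + 1)) (last_moved w) - a q"
    proof (cases "m = a q")
      case True
      then have "a q = a (max_index k a w)" using m_eq by metis
      moreover have "max_index k a w \<in> {1..k}" using p_pos p_le by simp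
      ultimately have "q = max_index k a w" using a_inject[OF q] by blast
      \<comment> \<open>Since \<open>last_moved w\<close> does not exceed the end of the block, its
        decrease towards \<open>u\<close> frees one place for the new factor.\<close>
      then have "last_moved w \<le> a (q + 1)" "m < last_moved w" using last_moved_bounds by auto
      then show ?thesis using bound True last_moved_u by simp
    next
      case False
      then show ?thesis using bound last_moved_u by simp
    qed
  qed
  moreover have "admissible (last_moved w) (snd x)" if "v \<in> ?R" "x \<in># G v" for v x
    using admissible_mono[OF G(2)[OF that] last_moved_others[OF that(1)]] .
  ultimately show ?case
    using F(2) finite_rec_others
    by (auto simp: expr_value_plus expr_value_times expr_value_uminus expr_value_sum set_mset_sum)
qed

end

section \<open>From formal products to index sequences\<close>

lemma elem_sym_zero [simp]: "elem_sym 0 m = 1"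
proof -
  have "{J. J \<subseteq> {1..m} \<and> card J = 0} = {{}}"
    using finite_subset[of _ "{1..m}"] by auto
  then show ?thesis by (simp add: elem_sym_def)
qed

lemma monomial_value_plus: "monomial_value (M + N) = monomial_value M * monomial_value N"
  by (simp add: monomial_value_def)

lemma monomial_value_sum: "monomial_value (\<Sum>x\<in>A. f x) = (\<Prod>x\<in>A. monomial_value (f x))"
  by (induction A rule: infinite_finite_induct) (simp_all add: monomial_value_plus, simp_all add: monomial_value_def)

lemma e_prod_eq_monomial_value: "e_prod k a I = monomial_value (e_formal k a I)"
proof -
  have filter: "monomial_value (filter_mset (\<lambda>(i, m). i \<noteq> 0) M) = monomial_value M" for M
    by (induction M) (auto simp: monomial_value_def)
  show ?thesis unfolding e_formal_def filter
    by (simp add: e_prod_def monomial_value_sum) (simp add: monomial_value_def)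
qed

lemma filter_mset_sum: "filter_mset P (\<Sum>x\<in>A. f x) = (\<Sum>x\<in>A. filter_mset P (f x))"
  by (induction A rule: infinite_finite_induct) simp_all

text \<open>The factors of one level fill the first places of its block, and index 0 pads the rest;
  the filter removes the padding.\<close>

lemma sum_singleton_block:
  assumes "length xs \<le> L" "0 \<notin> set xs"
    and f: "\<And>r. r \<in> {A..<A + L} \<Longrightarrow> f r = (if r - A < length xs then xs ! (r - A) else 0)"
  shows "filter_mset (\<lambda>(i, m). i \<noteq> 0) (\<Sum>r\<in>{A..<A + L}. {#(f r, m :: nat)#})
    = image_mset (\<lambda>i. (i, m)) (mset xs)"
proof -
  have "map f [A..<A + L] = xs @ replicate (L - length xs) 0"
    using assms(1) by (intro nth_equalityI) (auto simp: f nth_append)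
  have "(\<Sum>r\<in>{A..<A + L}. {#(f r, m)#}) = (\<Sum>r\<leftarrow>[A..<A + L]. {#(f r, m)#})"
    by (subst sum.distinct_set_conv_list[symmetric]) simp_all
  also have "\<dots> = image_mset (\<lambda>i. (i, m)) (mset (map f [A..<A + L]))"
    by (simp only: sum_list_singleton_mset mset_map multiset.map_comp o_def)
  also have "map f [A..<A + L] = xs @ replicate (L - length xs) 0" by fact
  finally have sum: "(\<Sum>r\<in>{A..<A + L}. {#(f r, m)#})
    = image_mset (\<lambda>i. (i, m)) (mset (xs @ replicate (L - length xs) 0))" .
  have "\<forall>x\<in>set xs. x \<noteq> 0" using assms(2) by metis
  then have "filter (\<lambda>i. i \<noteq> 0) (xs @ replicate (L - length xs) 0) = xs"
    unfolding filter_append by (simp only: filter_True) simp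
  then show ?thesis
    unfolding sum filter_mset_image_mset case_prod_conv mset_filter[symmetric] by simp
qed

context descent_positions
begin

lemma block_unique:
  assumes "q \<in> {1..k}" "q' \<in> {1..k}" "r \<in> {a q..<a (q + 1)}" "r \<in> {a q'..<a (q' + 1)}"
  shows "q = q'"
proof (rule ccontr)
  assume "q \<noteq> q'"
  then consider "q + 1 \<le> q'" | "q' + 1 \<le> q" by linarith
  then show False
    using a_le[of "q + 1" q'] a_le[of "q' + 1" q] assms by cases auto
qed

lemma sum_filter_levels:
  assumes "\<And>x. x \<in># M \<Longrightarrow> snd x \<in> a ` {1..k}"
  shows "(\<Sum>q\<in>{1..k}. {#x \<in># M. snd x = a q#}) = M"
  using assms
proof (induction M)
  case empty
  then show ?case by simp
next
  case (add x M)
  obtain q0 where q0: "q0 \<in> {1..k}" "snd x = a q0" using add.prems[of x] by auto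
  have "(\<Sum>q\<in>{1..k}. {#y \<in># add_mset x M. snd y = a q#})
      = (\<Sum>q\<in>{1..k}. (if q = q0 then {#x#} else {#}) + {#y \<in># M. snd y = a q#})"
    using q0 a_inject by (intro sum.cong) auto
  also have "\<dots> = {#x#} + M"
    using add q0 by (simp add: sum.distrib)
  finally show ?case by simp
qed

lemma admissible_e_formal:
  assumes "admissible t M"
  shows "\<exists>I\<in>index_seqs n k a. e_formal k a I = M"
proof -
  have "\<forall>q. \<exists>xs. mset xs = image_mset fst {#x \<in># M. snd x = a q#}" by (simp add: ex_mset)
  then obtain xs where xs: "\<And>q. mset (xs q) = image_mset fst {#x \<in># M. snd x = a q#}" by metis
  \<comment> \<open>The blocks are disjoint, so the description selects the block of
    \<open>r\<close>; \<open>undefined\<close> elsewhere is what \<open>extensional\<close>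
    demands.\<close>
  define I where "I = (\<lambda>r. if r \<in> {a 1..<n} then
    (let q = (THE q. q \<in> {1..k} \<and> r \<in> {a q..<a (q + 1)}) in
      if r - a q < length (xs q) then xs q ! (r - a q) else 0) else undefined)"
  have I: "I r = (if r - a q < length (xs q) then xs q ! (r - a q) else 0)"
    if q: "q \<in> {1..k}" "r \<in> {a q..<a (q + 1)}" for q r
  proof -
    have "(THE q. q \<in> {1..k} \<and> r \<in> {a q..<a (q + 1)}) = q"
      using q block_unique by (intro the_equality) auto
    moreover have "r \<in> {a 1..<n}"
      using q a_le[of 1 q] a_le_n[of "q + 1"] by auto
    ultimately show ?thesis by (simp add: I_def)
  qed
  have set_xs: "i \<in> set (xs q) \<Longrightarrow> q \<in> {1..k} \<Longrightarrow> 0 < i \<and> i \<le> a q" for i q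
  proof -
    assume "i \<in> set (xs q)" and q: "q \<in> {1..k}"
    then have "i \<in># image_mset fst {#x \<in># M. snd x = a q#}" unfolding xs[symmetric] by simp
    then obtain x where "x \<in># M" "snd x = a q" "i = fst x" by auto
    then show ?thesis using assms unfolding admissible_def by metis
  qed
  have len: "length (xs q) \<le> a (q + 1) - a q" if "q \<in> {1..k}" for q
  proof -
    have "length (xs q) = size {#x \<in># M. snd x = a q#}"
      using xs[of q] by (metis size_image_mset size_mset)
    also have "\<dots> \<le> min (a (q + 1)) t - a q" using assms that by (simp add: admissible_def)
    finally show ?thesis by simp
  qed
  have "I \<in> index_seqs n k a"
    unfolding index_seqs_def
  proof (intro CollectI conjI ballI)
    show "I \<in> extensional {a 1..<n}" by (simp add: I_def extensional_def)
    fix q r assume q: "q \<in> {1..k}" and r: "r \<in> {a q..<a (q + 1)}"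
    show "I r \<le> a q" using I[OF q r] set_xs[OF nth_mem q] by simp
  qed
  moreover have "e_formal k a I = M"
  proof -
    have "e_formal k a I = (\<Sum>q\<in>{1..k}. filter_mset (\<lambda>(i, m). i \<noteq> 0) (\<Sum>r\<in>{a q..<a (q + 1)}. {#(I r, a q)#}))"
      unfolding e_formal_def by (rule filter_mset_sum)
    also have "\<dots> = (\<Sum>q\<in>{1..k}. {#x \<in># M. snd x = a q#})"
    proof (rule sum.cong[OF refl])
      fix q assume q: "q \<in> {1..k}"
      let ?L = "a (q + 1) - a q"
      have eq: "a q + ?L = a (q + 1)" using a_le[of q "q + 1"] q by simp
      have nonzero: "0 \<notin> set (xs q)" using set_xs q by blast
      have I_block: "I r = (if r - a q < length (xs q) then xs q ! (r - a q) else 0)"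
        if "r \<in> {a q..<a q + ?L}" for r
        by (rule I[OF q]) (use that in \<open>simp only: eq\<close>)
      have "filter_mset (\<lambda>(i, m). i \<noteq> 0) (\<Sum>r\<in>{a q..<a q + ?L}. {#(I r, a q)#})
          = image_mset (\<lambda>i. (i, a q)) (mset (xs q))"
        by (rule sum_singleton_block[OF len[OF q] nonzero I_block])
      also have "\<dots> = image_mset id {#x \<in># M. snd x = a q#}"
        unfolding xs multiset.map_comp by (rule image_mset_cong) auto
      finally show "filter_mset (\<lambda>(i, m). i \<noteq> 0) (\<Sum>r\<in>{a q..<a (q + 1)}. {#(I r, a q)#})
          = {#x \<in># M. snd x = a q#}"
        by (simp only: eq image_mset.id id_apply)
    qed
    also have "\<dots> = M"
      using assms by (intro sum_filter_levels) (auto simp: admissible_def)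
    finally show ?thesis .
  qed
  ultimately show ?thesis by blast
qed

lemma expansion_e_prods:
  assumes F: "expansion n k a w F" and w: "w \<in> descent_perms n k a"
  shows "\<exists>T :: (int \<times> (nat \<Rightarrow> nat)) multiset.
    (\<forall>(c, I) \<in># T. I \<in> index_seqs n k a) \<and>
    F = image_mset (\<lambda>(c, I). (c, e_formal k a I)) T \<and>
    schubert n w = (\<Sum>(c, I) \<in># T. of_int c * e_prod k a I)"
proof -
  note val = expansion_value[OF F w]
  \<comment> \<open>One index sequence per formal product. Terms with equal products may share it,
    since \<open>T\<close> keeps multiplicities.\<close>
  define J where "J = (\<lambda>M. SOME I. I \<in> index_seqs n k a \<and> e_formal k a I = M)"
  have J: "J (snd x) \<in> index_seqs n k a \<and> e_formal k a (J (snd x)) = snd x" if "x \<in># F" for x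
  proof -
    have "admissible (last_moved w) (snd x)" using val that by simp
    then have "\<exists>I. I \<in> index_seqs n k a \<and> e_formal k a I = snd x"
      using admissible_e_formal by (metis (no_types))
    then show ?thesis unfolding J_def by (rule someI_ex)
  qed
  define T where "T = image_mset (\<lambda>x. (fst x, J (snd x))) F"
  have "image_mset (\<lambda>(c, I). (c, e_formal k a I)) T = image_mset id F"
    unfolding T_def multiset.map_comp by (rule image_mset_cong) (simp add: J)
  then have F_eq: "F = image_mset (\<lambda>(c, I). (c, e_formal k a I)) T" by simp
  have "schubert n w = expr_value F" using val by simp
  also have "\<dots> = (\<Sum>(c, I) \<in># T. of_int c * e_prod k a I)"
    unfolding expr_value_def
    by (subst F_eq)
      (simp add: multiset.map_comp o_def case_prod_unfold e_prod_eq_monomial_value)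
  finally have "schubert n w = (\<Sum>(c, I) \<in># T. of_int c * e_prod k a I)" .
  moreover have "\<forall>(c, I) \<in># T. I \<in> index_seqs n k a" using J by (auto simp: T_def)
  ultimately show ?thesis using F_eq by blast
qed

end

theorem mainTheorem4:
  fixes n k p :: nat and a w u \<alpha> :: "nat \<Rightarrow> nat"
  assumes "strict_mono_on {1..k} a"
    and "\<And>j. j \<in> {1..k} \<Longrightarrow> 0 < a j \<and> a j < n"
    and "a 0 = 0" and "a (k + 1) = n"
    and "w \<in> descent_perms n k a" and "w \<noteq> id"
    and "p = max_index k a w" and "u = rec_perm k a w" and "\<alpha> = rec_label k a w"
  shows
    \<comment> \<open>\<open>p\<close>, \<open>u\<close> and \<open>\<alpha>\<close> are well defined\<close>
    "(p \<le> k \<and> w (a p + 1) \<noteq> a p + 1 \<and> (\<forall>q\<in>{p<..k}. w (a q + 1) = a q + 1)) \<and>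
     w (a p + 1) < a p + 1 \<and>
     u \<in> descent_perms n k a \<and> \<alpha> \<in> descent_perms n k a \<and>
     \<comment> \<open>the identity\<close>
     schubert n w =
       schubert n u * elem_sym (a p + 1 - w (a p + 1)) (a p)
       - (\<Sum>v | arrow n \<alpha> u v \<and> v \<noteq> w. schubert n v) \<and>
     \<comment> \<open>the recursion stays in the domain of the identity and terminates\<close>
     schubert n id = 1 \<and>
     (\<forall>w'. (rec_call n k a)\<^sup>*\<^sup>* w' w \<longrightarrow> w' \<in> descent_perms n k a) \<and>
     wfp (rec_call n k a) \<and>
     \<comment> \<open>the resulting expression\<close>
     (\<exists>!F. expansion n k a w F) \<and>
     (\<forall>F. expansion n k a w F \<longrightarrow>
        (\<exists>T :: (int \<times> (nat \<Rightarrow> nat)) multiset.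
           (\<forall>(c, I) \<in># T. I \<in> index_seqs n k a) \<and>
           F = image_mset (\<lambda>(c, I). (c, e_formal k a I)) T \<and>
           schubert n w = (\<Sum>(c, I) \<in># T. of_int c * e_prod k a I)))"
proof -
  interpret descent_positions n k a
    by unfold_locales (use assms in auto)
  interpret recursion_step n k a w u p "a p" "w (a p + 1)"
    by unfold_locales (use assms in auto)
  have others: "{v. arrow n \<alpha> u v \<and> v \<noteq> w} = rec_others n k a w"
    by (simp add: rec_others_def assms)
  \<comment> \<open>Only the step out of \<open>w'\<close> matters, as \<open>rec_call\<close>
    already places its second argument in \<open>descent_perms\<close>.\<close>
  have domain: "w' \<in> descent_perms n k a" if "(rec_call n k a)\<^sup>*\<^sup>* w' w" for w'
    using that assms(5) by (cases rule: converse_rtranclpE) (auto dest: rec_call_descent_perms)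
  show ?thesis
    unfolding others
  proof (intro conjI allI impI)
    show "\<alpha> \<in> descent_perms n k a" using label_in_descent_perms by (simp add: assms)
    show "\<forall>q\<in>{p<..k}. w (a q + 1) = a q + 1" using fixed_positions by blast
    show "w (a p + 1) < a p + 1" using r_bounds by simp
    show "\<exists>!F. expansion n k a w F"
      using expansion_exists expansion_unique assms(5) by blast
  qed (use p_le nonfixed u_in_descent_perms schubert_recursion schubert_id domain wfp_rec_call
      expansion_e_prods assms(5) in blast)+
qed

end
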